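(* For each of (i)--(iii) below there exists a continuous family $(\mathbf p(t):t\in(0,1))$ of offspring distributions, of uniformly bounded support, with the given properties (where $D$ and $E^{(1)}$ are regarded as functions of $t$ via $\mathbf p(t)$). (i) The normal game has a (non-trivial) discontinuous phase transition: there exists $t^*\in(0,1)$ such that $D=0$ for $t<t^*$ while $D\in(0,1)$ for $t\ge t^*$ (and $p_1(t^* )<1$). (ii) The normal game has two phase transitions: there exist $0<t^-<t^+<1$ such that $D$ increases continuously from $0$ to positive values at $t^-$, and jumps discontinuously from one positive value to another at $t^+$. (iii) The escape game has a continuous phase transition: there exists $t_e\in(0,1)$ such that $E^{(1)}=0$ for $t\le t_e$ while $E^{(1)}\in(0,1)$ for $t>t_e$, and $E^{(1)}$ is a continuous function of $t$.
   Context: An offspring distribution is a probability mass function $\mathbf p=(p_0,p_1,\dots)$ on $\{0,1,2,\dots\}$. A family $\mathbf p(t)=(p_0(t),p_1(t),\dots)$ has uniformly bounded support if there is $K$ with $p_i(t)=0$ for all $i>K$ and all $t$; it is continuous if $t\mapsto\mathbf p(t)$ is continuous in the $\ell^1$ metric (equivalently here, each $p_i(t)$ is continuous). Let $\mathcal T$ be the Galton-Watson tree with offspring distribution $\mathbf p$, with edges directed from parents to children and root $o$. A token starts at $o$, and two players alternately move the token along a directed edge to a child of its current vertex. The tree is fully known to both players. A strategy for a player assigns to every vertex that has a child a legal move; it is winning if it yields a win for that player whatever strategy the opponent uses. Normal game: a player who cannot move loses and the other wins; the game is a draw if neither player has a winning strategy. Escape game: the players are Stopper and Escaper; Stopper wins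 if either player is ever unable to move; the game is a win for Escaper if Stopper has no winning strategy. $D$ is the probability (over $\mathcal T$) that the normal game is a draw. $E^{(1)}$ is the probability that Escaper wins the escape game when Escaper moves first. In (ii), "increases continuously from $0$ to positive values at $t^-$" means that $D$ is $0$ for $t\le t^-$ near $t^-$, positive for $t>t^-$ near $t^-$, and is continuous and nondecreasing near $t^-$; "jumps discontinuously from one positive value to another at $t^+$" means that the one-sided limits of $D$ at $t^+$ exist, are both positive, and are different. *)

theory Defs
  imports "HOL-Probability.Probability"
begin

text \<open>
  Vertices carry Ulam--Harris labels: the root is the empty list, and the children of \<open>v\<close>
  are \<open>v @ [i]\<close> for \<open>i < N v\<close>, where \<open>N\<close> assigns a number of children to every label.
  Taking the numbers \<open>N v\<close> independent with law \<open>p\<close> makes \<open>tree N\<close> the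
  Galton--Watson tree with offspring distribution \<open>p\<close>.
\<close>

type_synonym vertex = "nat list"

definition children :: "(vertex \<Rightarrow> nat) \<Rightarrow> vertex \<Rightarrow> vertex set" where
  "children N v = {v @ [i] | i. i < N v}"

inductive_set tree :: "(vertex \<Rightarrow> nat) \<Rightarrow> vertex set" for N :: "vertex \<Rightarrow> nat" where
  root: "[] \<in> tree N"
| child: "v \<in> tree N \<Longrightarrow> w \<in> children N v \<Longrightarrow> w \<in> tree N"

definition galton_watson :: "nat pmf \<Rightarrow> (vertex \<Rightarrow> nat) measure" where
  "galton_watson p = PiM UNIV (\<lambda>_. measure_pmf p)"

definition strategy :: "(vertex \<Rightarrow> nat) \<Rightarrow> (vertex \<Rightarrow> vertex) \<Rightarrow> bool" where
  "strategy N \<sigma> \<longleftrightarrow> (\<forall>v\<in>tree N. children N v \<noteq> {} \<longrightarrow> \<sigma> v \<in> children N v)"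

text \<open>
  In \<open>play \<sigma> \<tau>\<close> the player moving first uses \<open>\<sigma>\<close> and the other one \<open>\<tau>\<close>.
  Positions after the first childless vertex are meaningless, which is why \<open>ends_at\<close>
  selects the first time at which the player to move is unable to do so.
\<close>

fun play :: "(vertex \<Rightarrow> vertex) \<Rightarrow> (vertex \<Rightarrow> vertex) \<Rightarrow> nat \<Rightarrow> vertex" where
  "play \<sigma> \<tau> 0 = []"
| "play \<sigma> \<tau> (Suc n) = (if even n then \<sigma> else \<tau>) (play \<sigma> \<tau> n)"

definition ends_at ::
  "(vertex \<Rightarrow> nat) \<Rightarrow> (vertex \<Rightarrow> vertex) \<Rightarrow> (vertex \<Rightarrow> vertex) \<Rightarrow> nat \<Rightarrow> bool" where
  "ends_at N \<sigma> \<tau> n \<longleftrightarrow>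
     children N (play \<sigma> \<tau> n) = {} \<and> (\<forall>m<n. children N (play \<sigma> \<tau> m) \<noteq> {})"

text \<open>At time \<open>n\<close> the first player is to move if \<open>n\<close> is even, the second if it is odd.\<close>

definition first_has_winning_strategy :: "(vertex \<Rightarrow> nat) \<Rightarrow> bool" where
  "first_has_winning_strategy N \<longleftrightarrow>
     (\<exists>\<sigma>. strategy N \<sigma> \<and> (\<forall>\<tau>. strategy N \<tau> \<longrightarrow> (\<exists>n. ends_at N \<sigma> \<tau> n \<and> odd n)))"

definition second_has_winning_strategy :: "(vertex \<Rightarrow> nat) \<Rightarrow> bool" where
  "second_has_winning_strategy N \<longleftrightarrow>
     (\<exists>\<tau>. strategy N \<tau> \<and> (\<forall>\<sigma>. strategy N \<sigma> \<longrightarrow> (\<exists>n. ends_at N \<sigma> \<tau> n \<and> even n)))"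

definition normal_draw :: "(vertex \<Rightarrow> nat) \<Rightarrow> bool" where
  "normal_draw N \<longleftrightarrow> \<not> first_has_winning_strategy N \<and> \<not> second_has_winning_strategy N"

text \<open>The escape game with Escaper moving first, so that Stopper uses \<open>\<tau>\<close>.\<close>

definition stopper_has_winning_strategy :: "(vertex \<Rightarrow> nat) \<Rightarrow> bool" where
  "stopper_has_winning_strategy N \<longleftrightarrow>
     (\<exists>\<tau>. strategy N \<tau> \<and> (\<forall>\<sigma>. strategy N \<sigma> \<longrightarrow> (\<exists>n. ends_at N \<sigma> \<tau> n)))"

definition draw_prob :: "nat pmf \<Rightarrow> real" where
  "draw_prob p = \<P>(N in galton_watson p. normal_draw N)"

definition escape_prob1 :: "nat pmf \<Rightarrow> real" where
  "escape_prob1 p = \<P>(N in galton_watson p. \<not> stopper_has_winning_strategy N)"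

definition l1_dist :: "nat pmf \<Rightarrow> nat pmf \<Rightarrow> real" where
  "l1_dist p q = (\<Sum>i. \<bar>pmf p i - pmf q i\<bar>)"

text \<open>Families are indexed by \<open>t \<in> (0,1)\<close>; values at other reals are never used.\<close>

definition bounded_support_family :: "(real \<Rightarrow> nat pmf) \<Rightarrow> bool" where
  "bounded_support_family p \<longleftrightarrow> (\<exists>K. \<forall>t\<in>{0<..<1}. \<forall>i>K. pmf (p t) i = 0)"

definition continuous_family :: "(real \<Rightarrow> nat pmf) \<Rightarrow> bool" where
  "continuous_family p \<longleftrightarrow>
     (\<forall>t\<in>{0<..<1}. ((\<lambda>s. l1_dist (p s) (p t)) \<longlongrightarrow> 0) (at t within {0<..<1}))"

definition increases_continuously_from_0_at :: "(real \<Rightarrow> real) \<Rightarrow> real \<Rightarrow> bool" where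
  "increases_continuously_from_0_at f a \<longleftrightarrow>
     (\<exists>\<epsilon>>0. {a - \<epsilon><..<a + \<epsilon>} \<subseteq> {0<..<1} \<and>
        (\<forall>t\<in>{a - \<epsilon><..a}. f t = 0) \<and> (\<forall>t\<in>{a<..<a + \<epsilon>}. f t > 0) \<and>
        continuous_on {a - \<epsilon><..<a + \<epsilon>} f \<and> mono_on {a - \<epsilon><..<a + \<epsilon>} f)"

definition jumps_between_positive_values_at :: "(real \<Rightarrow> real) \<Rightarrow> real \<Rightarrow> bool" where
  "jumps_between_positive_values_at f a \<longleftrightarrow>
     (\<exists>l r. (f \<longlongrightarrow> l) (at_left a) \<and> (f \<longlongrightarrow> r) (at_right a) \<and> l > 0 \<and> r > 0 \<and> l \<noteq> r)"

end

theory Submission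
  imports Defs "HOL-Library.Sublist"
begin

text \<open>
  Both games are solved by backward induction on the number of remaining moves, and subtrees at siblings are
  independent, so the winning probabilities satisfy fixed point equations in the generating
  function \<open>G\<close>. With \<open>F z = 1 - G z\<close>, the draw probability is \<open>x - w\<close> for the extremal pair
  \<open>w \<le> x\<close> with \<open>x = F w\<close> and \<open>w = F x\<close>. The escape probability is the largest \<open>x\<close> with
  \<open>x = 1 - G (1 - y)\<close> and \<open>y = G x - G 0\<close>.

  (i) For \<open>G z = 1 - s + s * (z^2 + z^16) / 2\<close> the points of a nontrivial \<open>2\<close>-cycle stay away from
  each other, since \<open>F\<close> has slope above \<open>-1\<close> up to a point well beyond its fixed point. Hence the
  set of \<open>s \<le> 999/1000\<close> with a nontrivial cycle is compact, and its minimum is a jump.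

  (ii) For \<open>0\<close> or \<open>2\<close> children the cycle solves a quadratic equation with discriminant
  \<open>4 - 3 / s^2\<close>, which gives the continuous transition. For \<open>0\<close>, \<open>1\<close> or \<open>3\<close> children and
  \<open>G 0 > 0\<close> small, a single cycle survives, with gap far below \<open>1\<close>, but at \<open>G 0 = 0\<close> every game
  is drawn.

  (iii) For \<open>0\<close>, \<open>1\<close> or \<open>3\<close> children the fixed point equation is linear in the two free weights,
  which can therefore be chosen so that a prescribed small \<open>x\<close> is the escape probability.
\<close>

section \<open>Determinacy\<close>

text \<open>
  The hero wins if the opponent is unable to move; \<open>c\<close> says whether he also wins if he is himself
  unable to move, as Stopper does in the escape game. In \<open>forced\<close> the opponent is to move, in
  \<open>can_force\<close> the hero, and the number bounds the length of the play from there.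
\<close>

fun forced :: "bool \<Rightarrow> nat \<Rightarrow> (vertex \<Rightarrow> nat) \<Rightarrow> vertex \<Rightarrow> bool"
  and can_force :: "bool \<Rightarrow> nat \<Rightarrow> (vertex \<Rightarrow> nat) \<Rightarrow> vertex \<Rightarrow> bool" where
  "forced c 0 N v \<longleftrightarrow> False"
| "forced c (Suc n) N v \<longleftrightarrow> (\<forall>i<N v. can_force c n N (v @ [i]))"
| "can_force c 0 N v \<longleftrightarrow> False"
| "can_force c (Suc n) N v \<longleftrightarrow> c \<and> N v = 0 \<or> (\<exists>i<N v. forced c n N (v @ [i]))"

lemma forced_Suc_mono:
  "(forced c n N v \<longrightarrow> forced c (Suc n) N v) \<and> (can_force c n N v \<longrightarrow> can_force c (Suc n) N v)"
  by (induction n arbitrary: v) (simp, metis forced.simps(2) can_force.simps(2))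

lemma forced_mono: "forced c m N v \<Longrightarrow> m \<le> n \<Longrightarrow> forced c n N v"
  using forced_Suc_mono[of c _ N v] by (metis lift_Suc_mono_le[of "\<lambda>n. forced c n N v"] le_boolE le_boolI)

lemma can_force_mono: "can_force c m N v \<Longrightarrow> m \<le> n \<Longrightarrow> can_force c n N v"
  using forced_Suc_mono[of c _ N v] by (metis lift_Suc_mono_le[of "\<lambda>n. can_force c n N v"] le_boolE le_boolI)

text \<open>Branching is finite: the maximum of the bounds for the individual children serves all of
  them. This makes a win without a length bound the same as a win with some bound.\<close>

lemma ex_forced_iff:
  "(\<exists>n. forced c n N v) \<longleftrightarrow> (\<forall>i<N v. \<exists>n. can_force c n N (v @ [i]))"
proof
  assume "\<exists>n. forced c n N v"
  then obtain n where "forced c n N v" by blast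
  then show "\<forall>i<N v. \<exists>n. can_force c n N (v @ [i])" by (cases n) auto
next
  assume "\<forall>i<N v. \<exists>n. can_force c n N (v @ [i])"
  then obtain f where f: "can_force c (f i) N (v @ [i])" if "i < N v" for i by metis
  have "can_force c (Max (f ` {..<N v})) N (v @ [i])" if "i < N v" for i
    using can_force_mono[OF f[OF that]] that by simp
  then have "forced c (Suc (Max (f ` {..<N v}))) N v" by simp
  then show "\<exists>n. forced c n N v" by blast
qed

lemma ex_can_force_iff:
  "(\<exists>n. can_force c n N v) \<longleftrightarrow> c \<and> N v = 0 \<or> (\<exists>i<N v. \<exists>n. forced c n N (v @ [i]))"
proof
  assume "\<exists>n. can_force c n N v"
  then obtain n where "can_force c n N v" by blast
  then show "c \<and> N v = 0 \<or> (\<exists>i<N v. \<exists>n. forced c n N (v @ [i]))" by (cases n) auto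
next
  assume "c \<and> N v = 0 \<or> (\<exists>i<N v. \<exists>n. forced c n N (v @ [i]))"
  then obtain n where "can_force c (Suc n) N v" by auto
  then show "\<exists>n. can_force c n N v" by blast
qed

text \<open>The move witnessing \<open>can_force\<close> leads to a child where both properties hold
  again with the bounds swapped and lowered. At a leaf only one of them can hold because
  \<open>c\<close> is \<open>False\<close>.\<close>

lemma not_forced_and_can_force: "\<not> (forced False n N v \<and> can_force False m N v)"
proof (induction "n + m" arbitrary: n m v rule: less_induct)
  case less
  show ?case
  proof (cases n; cases m)
    fix n' m' assume nm: "n = Suc n'" "m = Suc m'"
    show ?thesis
    proof
      assume "forced False n N v \<and> can_force False m N v"
      then obtain i where "can_force False n' N (v @ [i])" "forced False m' N (v @ [i])"
        unfolding nm by auto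
      then show False using less[of m' n' "v @ [i]"] nm by simp
    qed
  qed auto
qed

section \<open>Plays seen by the hero, and the two kinds of optimal strategy\<close>

text \<open>The predicate \<open>turn\<close> marks the times at which the hero moves, so one
  analysis covers a hero who moves first and one who moves second.\<close>

primrec run :: "(nat \<Rightarrow> bool) \<Rightarrow> (vertex \<Rightarrow> vertex) \<Rightarrow> (vertex \<Rightarrow> vertex) \<Rightarrow> nat \<Rightarrow> vertex" where
  "run turn \<eta> \<omega> 0 = []"
| "run turn \<eta> \<omega> (Suc n) = (if turn n then \<eta> else \<omega>) (run turn \<eta> \<omega> n)"

lemma children_empty_iff: "children N v = {} \<longleftrightarrow> N v = 0"
  by (auto simp: children_def)

lemma strategy_move:
  assumes "strategy N \<sigma>" "v \<in> tree N" "N v \<noteq> 0"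
  shows "\<exists>i<N v. \<sigma> v = v @ [i]" "\<sigma> v \<in> tree N"
proof -
  have *: "\<sigma> v \<in> children N v" using assms by (auto simp: strategy_def children_empty_iff)
  then show "\<exists>i<N v. \<sigma> v = v @ [i]" by (auto simp: children_def)
  show "\<sigma> v \<in> tree N" using * assms(2) tree.child by blast
qed

lemma run_in_tree:
  assumes "strategy N \<eta>" "strategy N \<omega>" "\<forall>m<n. N (run turn \<eta> \<omega> m) \<noteq> 0"
  shows "run turn \<eta> \<omega> n \<in> tree N"
  using assms(3)
proof (induction n)
  case 0
  show ?case using tree.root by simp
next
  case (Suc n)
  then show ?case using strategy_move(2)[of N _ "run turn \<eta> \<omega> n"] assms(1,2) by simp
qed

definition hero_wins :: "bool \<Rightarrow> (vertex \<Rightarrow> nat) \<Rightarrow> (nat \<Rightarrow> bool) \<Rightarrow> (nat \<Rightarrow> vertex) \<Rightarrow> bool" where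
  "hero_wins c N turn pos \<longleftrightarrow>
     (\<exists>e. N (pos e) = 0 \<and> (\<forall>m<e. N (pos m) \<noteq> 0) \<and> (turn e \<longrightarrow> c))"

text \<open>The default child \<open>0\<close> keeps the move legal at every vertex that has a
  child.\<close>

definition choose_child :: "(vertex \<Rightarrow> nat) \<Rightarrow> (vertex \<Rightarrow> bool) \<Rightarrow> vertex \<Rightarrow> vertex" where
  "choose_child N P v =
     v @ [if \<exists>i<N v. P (v @ [i]) then SOME i. i < N v \<and> P (v @ [i]) else 0]"

lemma choose_child_sat: "\<exists>i<N v. P (v @ [i]) \<Longrightarrow> P (choose_child N P v)"
  unfolding choose_child_def using someI_ex[of "\<lambda>i. i < N v \<and> P (v @ [i])"] by auto

lemma choose_child_in_children: "N v \<noteq> 0 \<Longrightarrow> choose_child N P v \<in> children N v"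
  unfolding choose_child_def children_def
  using someI_ex[of "\<lambda>i. i < N v \<and> P (v @ [i])"] by auto

text \<open>Decreasing the bound on the remaining length at every move of the hero makes the play end.\<close>

definition attractor_strategy :: "bool \<Rightarrow> (vertex \<Rightarrow> nat) \<Rightarrow> vertex \<Rightarrow> vertex" where
  "attractor_strategy c N v =
     choose_child N (forced c (LEAST n. \<exists>i<N v. forced c n N (v @ [i])) N) v"

lemma strategy_attractor: "strategy N (attractor_strategy c N)"
  by (simp add: strategy_def attractor_strategy_def choose_child_in_children children_empty_iff)

text \<open>The strategy sees only the vertex and not the bound \<open>n\<close>. The least bound it
  aims for is at most \<open>n\<close>, and monotonicity does the rest.\<close>

lemma attractor_strategy_forced:
  assumes "can_force c (Suc n) N v" "N v \<noteq> 0"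
  shows "forced c n N (attractor_strategy c N v)"
proof -
  define n0 where "n0 = (LEAST n. \<exists>i<N v. forced c n N (v @ [i]))"
  have ex: "\<exists>i<N v. forced c n N (v @ [i])" using assms by auto
  then have "\<exists>i<N v. forced c n0 N (v @ [i])" unfolding n0_def by (rule LeastI)
  then have "forced c n0 N (attractor_strategy c N v)"
    unfolding attractor_strategy_def n0_def[symmetric] by (rule choose_child_sat)
  moreover have "n0 \<le> n" unfolding n0_def using ex by (rule Least_le)
  ultimately show ?thesis by (rule forced_mono)
qed

lemma attractor_strategy_wins:
  assumes turn: "\<And>n. turn (Suc n) \<longleftrightarrow> \<not> turn n" and \<omega>: "strategy N \<omega>"
    and win: "if turn 0 then can_force c n N [] else forced c n N []"
  shows "hero_wins c N turn (run turn (attractor_strategy c N) \<omega>)"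
proof -
  let ?pos = "run turn (attractor_strategy c N) \<omega>"
  \<comment> \<open>Generalised over the time \<open>k\<close>: every move uses up one unit of the
    bound \<open>n\<close>, and bound \<open>0\<close> is never winning.\<close>
  have "hero_wins c N turn ?pos"
    if "\<forall>m<k. N (?pos m) \<noteq> 0"
      "if turn k then can_force c n N (?pos k) else forced c n N (?pos k)" for k n
    using that
  proof (induction n arbitrary: k)
    case 0
    then show ?case by (simp split: if_splits)
  next
    case (Suc n)
    show ?case
    proof (cases "N (?pos k) = 0")
      case True
      then have "turn k \<longrightarrow> c" using Suc.prems(2) by (auto split: if_splits)
      then show ?thesis using True Suc.prems(1) unfolding hero_wins_def by blast
    next
      case False
      have in_tree: "?pos k \<in> tree N"
        using run_in_tree[OF strategy_attractor \<omega>] Suc.prems(1) by blast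
      have "if turn (Suc k) then can_force c n N (?pos (Suc k)) else forced c n N (?pos (Suc k))"
        using Suc.prems(2) attractor_strategy_forced[of c n N "?pos k"] False
          strategy_move(1)[OF \<omega> in_tree False] by (auto simp: turn split: if_splits)
      moreover have "\<forall>m<Suc k. N (?pos m) \<noteq> 0" using Suc.prems(1) False less_Suc_eq by auto
      ultimately show ?thesis by (rule Suc.IH[rotated])
    qed
  qed
  from this[of 0 n] show ?thesis using win by simp
qed

definition avoiding_strategy :: "bool \<Rightarrow> (vertex \<Rightarrow> nat) \<Rightarrow> vertex \<Rightarrow> vertex" where
  "avoiding_strategy c N = choose_child N (\<lambda>w. \<nexists>n. can_force c n N w)"

lemma strategy_avoiding: "strategy N (avoiding_strategy c N)"
  by (simp add: strategy_def avoiding_strategy_def choose_child_in_children children_empty_iff)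

lemma avoiding_strategy_not_can_force:
  assumes "\<nexists>n. forced c n N v"
  shows "\<nexists>n. can_force c n N (avoiding_strategy c N v)"
proof -
  have "\<exists>i<N v. \<nexists>n. can_force c n N (v @ [i])" using assms ex_forced_iff by blast
  then show ?thesis unfolding avoiding_strategy_def by (rule choose_child_sat)
qed

text \<open>The positions that are not winning for the hero form a trap: the hero has no move out of
  it, and the avoiding strategy always has a move that stays inside.\<close>

lemma avoiding_strategy_avoids:
  assumes turn: "\<And>n. turn (Suc n) \<longleftrightarrow> \<not> turn n" and \<eta>: "strategy N \<eta>"
    and no_win: "\<not> (if turn 0 then \<exists>n. can_force c n N [] else \<exists>n. forced c n N [])"
  shows "\<not> hero_wins c N turn (run turn \<eta> (avoiding_strategy c N))"
proof -
  let ?pos = "run turn \<eta> (avoiding_strategy c N)"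
  have inv: "\<not> (if turn k then \<exists>n. can_force c n N (?pos k) else \<exists>n. forced c n N (?pos k))"
    if "\<forall>m<k. N (?pos m) \<noteq> 0" for k
    using that
  proof (induction k)
    case 0
    show ?case unfolding run.simps by (rule no_win)
  next
    case (Suc k)
    then have IH: "\<not> (if turn k then \<exists>n. can_force c n N (?pos k) else \<exists>n. forced c n N (?pos k))"
      and stuck: "N (?pos k) \<noteq> 0" by auto
    have in_tree: "?pos k \<in> tree N"
      using run_in_tree[OF \<eta> strategy_avoiding] Suc.prems by simp
    show ?case
    proof (cases "turn k")
      case True
      then have "\<nexists>n. can_force c n N (?pos k)" using IH by simp
      then have "\<forall>i<N (?pos k). \<nexists>n. forced c n N (?pos k @ [i])"
        using ex_can_force_iff by blast
      then show ?thesis using True strategy_move(1)[OF \<eta> in_tree stuck] by (auto simp: turn)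
    next
      case False
      then show ?thesis using avoiding_strategy_not_can_force IH by (simp add: turn)
    qed
  qed
  show ?thesis
  proof
    assume "hero_wins c N turn ?pos"
    then obtain e where e: "N (?pos e) = 0" "\<forall>m<e. N (?pos m) \<noteq> 0" "turn e \<longrightarrow> c"
      unfolding hero_wins_def by blast
    \<comment> \<open>The final position of a won play is winning with bound \<open>1\<close>, so it
      lies outside the trap.\<close>
    then have "if turn e then can_force c (Suc 0) N (?pos e) else forced c (Suc 0) N (?pos e)"
      by (cases c) simp_all
    then show False using inv[OF e(2)] by metis
  qed
qed

lemma winning_strategy_iff:
  assumes turn: "\<And>n. turn (Suc n) \<longleftrightarrow> \<not> turn n"
  shows "(\<exists>\<eta>. strategy N \<eta> \<and> (\<forall>\<omega>. strategy N \<omega> \<longrightarrow> hero_wins c N turn (run turn \<eta> \<omega>))) \<longleftrightarrow>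
    (if turn 0 then \<exists>n. can_force c n N [] else \<exists>n. forced c n N [])"
proof (cases "if turn 0 then \<exists>n. can_force c n N [] else \<exists>n. forced c n N []")
  case True
  then obtain n where "if turn 0 then can_force c n N [] else forced c n N []" by metis
  then show ?thesis
    using attractor_strategy_wins[where turn = turn] strategy_attractor turn True by metis
next
  case False
  then show ?thesis
    using avoiding_strategy_avoids[where turn = turn] strategy_avoiding turn by metis
qed

section \<open>The outcomes of both games in terms of winning positions\<close>

lemma play_eq_run_even: "play \<sigma> \<tau> n = run even \<sigma> \<tau> n"
  by (induction n) auto

text \<open>For a hero who moves second the strategies trade places, since \<open>run\<close> takes
  the strategy of the hero first.\<close>

lemma play_eq_run_odd: "play \<sigma> \<tau> n = run odd \<tau> \<sigma> n"
  by (induction n) auto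

lemma first_has_winning_strategy_iff:
  "first_has_winning_strategy N \<longleftrightarrow> (\<exists>n. can_force False n N [])"
  using winning_strategy_iff[of even N False]
  by (simp add: first_has_winning_strategy_def ends_at_def hero_wins_def children_empty_iff
      play_eq_run_even)

lemma second_has_winning_strategy_iff:
  "second_has_winning_strategy N \<longleftrightarrow> (\<exists>n. forced False n N [])"
  using winning_strategy_iff[of odd N False]
  by (simp add: second_has_winning_strategy_def ends_at_def hero_wins_def children_empty_iff
      play_eq_run_odd)

lemma stopper_has_winning_strategy_iff:
  "stopper_has_winning_strategy N \<longleftrightarrow> (\<exists>n. forced True n N [])"
  using winning_strategy_iff[of odd N True]
  by (simp add: stopper_has_winning_strategy_def ends_at_def hero_wins_def children_empty_iff
      play_eq_run_odd)

section \<open>Generating functions\<close>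

definition pgf :: "nat pmf \<Rightarrow> real \<Rightarrow> real" where
  "pgf p x = (\<Sum>k. pmf p k * x ^ k)"

lemma pmf_sums_1: "pmf (p :: nat pmf) sums 1"
proof -
  have "(\<lambda>k. measure p {k}) sums measure p (\<Union>k. {k})"
    by (rule measure_pmf.finite_measure_UNION) (auto simp: disjoint_family_on_def)
  then show ?thesis by (simp add: pmf.rep_eq)
qed

lemmas summable_pmf_nat = sums_summable[OF pmf_sums_1]

lemma pgf_sums:
  assumes "0 \<le> x" "x \<le> 1"
  shows "(\<lambda>k. pmf p k * x ^ k) sums pgf p x"
  unfolding pgf_def
  by (rule summable_sums, rule summable_comparison_test'[OF summable_pmf_nat[of p]])
     (simp add: assms abs_mult mult_left_le power_le_one)

lemma pgf_1: "pgf p 1 = 1"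
  using pmf_sums_1 by (simp add: pgf_def sums_iff)

lemma pgf_0: "pgf p 0 = pmf p 0"
  using sums_unique[OF sums_single[of 0 "pmf p"]]
  by (simp add: pgf_def power_0_left if_distrib cong: if_cong)

lemma pgf_mono:
  assumes "0 \<le> x" "x \<le> y" "y \<le> 1"
  shows "pgf p x \<le> pgf p y"
  by (rule sums_le[OF _ pgf_sums pgf_sums]) (use assms in \<open>auto intro!: mult_left_mono power_mono\<close>)

lemma pgf_bounds:
  assumes "0 \<le> x" "x \<le> 1"
  shows "pmf p 0 \<le> pgf p x" "pgf p x \<le> 1" "0 \<le> pgf p x"
proof -
  show "pmf p 0 \<le> pgf p x" "pgf p x \<le> 1"
    using pgf_mono[of 0 x p] pgf_mono[of x 1 p] pgf_1[of p] pgf_0[of p] assms by auto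
  then show "0 \<le> pgf p x" using pmf_nonneg[of p 0] by linarith
qed

lemma continuous_on_pgf: "continuous_on {0..1} (pgf p)"
proof -
  have "uniform_limit {0..1} (\<lambda>n x. \<Sum>k<n. pmf p k * x ^ k) (pgf p) sequentially"
    unfolding pgf_def
    by (rule Weierstrass_m_test[OF _ summable_pmf_nat[of p]])
       (auto simp: abs_mult mult_left_le power_le_one)
  then show ?thesis
    by (rule uniform_limit_theorem[rotated]) (auto intro!: continuous_intros always_eventually)
qed

lemma tendsto_pgf:
  assumes "f \<longlonglongrightarrow> l" "\<And>n. 0 \<le> f n" "\<And>n. f n \<le> 1"
  shows "(\<lambda>n. pgf p (f n)) \<longlonglongrightarrow> pgf p l"
proof -
  have "0 \<le> l" "l \<le> 1"
    using LIMSEQ_le_const[OF assms(1)] LIMSEQ_le_const2[OF assms(1)] assms(2,3) by auto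
  then show ?thesis
    using continuous_on_tendsto_compose[OF continuous_on_pgf assms(1)] assms(2,3) by auto
qed

section \<open>Independence of subtrees\<close>

definition descendants :: "vertex \<Rightarrow> vertex set" where
  "descendants v = {u. prefix v u}"

lemma descendants_refl: "v \<in> descendants v" by (simp add: descendants_def)

lemma descendants_child_subset: "descendants (v @ [i]) \<subseteq> descendants v"
  by (auto simp: descendants_def prefix_def)

lemma descendants_child_disjoint: "i \<noteq> j \<Longrightarrow> descendants (v @ [i]) \<inter> descendants (v @ [j]) = {}"
  by (auto simp: descendants_def prefix_def)

lemma not_in_descendants_child: "v \<notin> descendants (v @ [i])"
  by (simp add: descendants_def)

lemma forced_cong:
  assumes "\<And>u. u \<in> descendants v \<Longrightarrow> N u = N' u"
  shows "(forced c n N v \<longleftrightarrow> forced c n N' v) \<and> (can_force c n N v \<longleftrightarrow> can_force c n N' v)"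
  using assms
proof (induction n arbitrary: v)
  case (Suc n)
  have "(forced c n N (v @ [i]) \<longleftrightarrow> forced c n N' (v @ [i])) \<and>
      (can_force c n N (v @ [i]) \<longleftrightarrow> can_force c n N' (v @ [i]))" for i
    by (rule Suc.IH) (use Suc.prems descendants_child_subset in blast)
  then show ?case using Suc.prems[OF descendants_refl] by simp
qed simp

text \<open>An arbitrary \<open>K\<close> is allowed because independence needs measurability on the
  coordinates of a single subtree, while the events themselves live on all coordinates.\<close>

lemma forced_measurable:
  assumes "descendants v \<subseteq> K"
  shows "Measurable.pred (PiM K (\<lambda>_. measure_pmf p)) (\<lambda>N. forced c n N v) \<and>
    Measurable.pred (PiM K (\<lambda>_. measure_pmf p)) (\<lambda>N. can_force c n N v)"
  using assms
proof (induction n arbitrary: v)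
  case (Suc n)
  have v: "v \<in> K" using Suc.prems descendants_refl by blast
  have [measurable]: "(\<lambda>N. N v) \<in> measurable (PiM K (\<lambda>_. measure_pmf p)) (count_space UNIV)"
    using measurable_component_singleton[OF v, of "\<lambda>_. measure_pmf p"] by simp
  have [measurable]: "Measurable.pred (PiM K (\<lambda>_. measure_pmf p)) (\<lambda>N. forced c n N (v @ [i]))"
    "Measurable.pred (PiM K (\<lambda>_. measure_pmf p)) (\<lambda>N. can_force c n N (v @ [i]))" for i
    using Suc.IH[of "v @ [i]"] Suc.prems descendants_child_subset by blast+
  show ?case by simp
qed simp

lemma prob_space_galton_watson: "prob_space (galton_watson p)"
  unfolding galton_watson_def by (rule prob_space_PiM) (rule prob_space_measure_pmf)

context
  fixes p :: "nat pmf"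
begin

interpretation GW: prob_space "galton_watson p"
  by (rule prob_space_galton_watson)

lemma space_galton_watson: "space (galton_watson p) = UNIV"
  by (simp add: galton_watson_def space_PiM)

lemma forced_sets:
  "{N. forced c n N v} \<in> sets (galton_watson p)" "{N. can_force c n N v} \<in> sets (galton_watson p)"
  using forced_measurable[of v UNIV c n p] space_galton_watson
  by (auto simp: pred_def galton_watson_def)

lemma offspring_sets: "{N. N v = k} \<in> sets (galton_watson p)"
proof -
  have "(\<lambda>N. N v) \<in> measurable (galton_watson p) (count_space UNIV)"
    using measurable_component_singleton[of v UNIV "\<lambda>_. measure_pmf p"]
    by (simp add: galton_watson_def)
  then show ?thesis
    using measurable_sets[of "\<lambda>N. N v" "galton_watson p" "count_space UNIV" "{k}"]
    by (simp add: space_galton_watson vimage_def)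
qed

lemma prob_offspring: "GW.prob {N. N v = k} = pmf p k"
proof -
  interpret product_prob_space "\<lambda>_. measure_pmf p" UNIV
    by (simp add: product_prob_space_def product_prob_space_axioms_def product_sigma_finite_def
        prob_space_measure_pmf prob_space_imp_sigma_finite)
  have "GW.prob {N. N v = k} = measure (distr (galton_watson p) (measure_pmf p) (\<lambda>N. N v)) {k}"
    by (subst measure_distr) (auto simp: galton_watson_def space_PiM vimage_def)
  then show ?thesis by (simp add: galton_watson_def PiM_component pmf.rep_eq)
qed

lemma indep_vars_offspring: "GW.indep_vars (\<lambda>_. measure_pmf p) (\<lambda>v N. N v) UNIV"
proof -
  interpret product_prob_space "\<lambda>_. measure_pmf p" UNIV
    by (simp add: product_prob_space_def product_prob_space_axioms_def product_sigma_finite_def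
        prob_space_measure_pmf prob_space_imp_sigma_finite)
  have "distr (galton_watson p) (PiM UNIV (\<lambda>_. measure_pmf p)) (\<lambda>N. \<lambda>v\<in>UNIV. N v) =
      PiM UNIV (\<lambda>v. distr (galton_watson p) (measure_pmf p) (\<lambda>N. N v))"
    by (simp add: galton_watson_def PiM_component restrict_UNIV)
  then show ?thesis
    by (subst GW.indep_vars_iff_distr_eq_PiM) (auto simp: galton_watson_def)
qed

text \<open>The number of children of \<open>v\<close> and the subtrees at these children use
  disjoint sets of coordinates, hence are independent. The assumptions \<open>meas\<close> and
  \<open>local\<close> make \<open>Q i\<close> an event about the subtree at
  \<open>v @ [i]\<close>.\<close>

lemma prob_children:
  assumes meas: "\<And>K i. descendants (v @ [i]) \<subseteq> K \<Longrightarrow> Measurable.pred (PiM K (\<lambda>_. measure_pmf p)) (Q i)"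
    and local: "\<And>i N N'. (\<And>u. u \<in> descendants (v @ [i]) \<Longrightarrow> N u = N' u) \<Longrightarrow> Q i N \<longleftrightarrow> Q i N'"
    and prob_Q: "\<And>i. GW.prob {N. Q i N} = q"
  shows "GW.prob {N. N v = k \<and> (\<forall>i<k. Q i N)} = pmf p k * q ^ k"
proof -
  \<comment> \<open>Block \<open>0\<close> is the vertex \<open>v\<close> itself and block
    \<open>Suc i\<close> the subtree at its child \<open>i\<close>, so \<open>k\<close> children
    need the indices \<open>{..k}\<close>.\<close>
  define K where "K j = (case j of 0 \<Rightarrow> {v} | Suc i \<Rightarrow> descendants (v @ [i]))" for j
  define R where "R j N \<longleftrightarrow> (case j of 0 \<Rightarrow> N v = k | Suc i \<Rightarrow> Q i N)" for j N
  have disj: "disjoint_family_on K {..k}"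
    using descendants_child_disjoint not_in_descendants_child
    by (auto simp: disjoint_family_on_def K_def split: nat.splits)
  have indep: "GW.indep_vars (\<lambda>j. PiM (K j) (\<lambda>_. measure_pmf p)) (\<lambda>j N. restrict N (K j)) {..k}"
    using GW.indep_vars_restrict[OF indep_vars_offspring _ disj] by simp
  have R_sets: "{N \<in> space (PiM (K j) (\<lambda>_. measure_pmf p)). R j N} \<in> sets (PiM (K j) (\<lambda>_. measure_pmf p))" for j
  proof (cases j)
    case 0
    have "(\<lambda>N. N v) \<in> measurable (PiM {v} (\<lambda>_. measure_pmf p)) (count_space UNIV)"
      using measurable_component_singleton[of v "{v}" "\<lambda>_. measure_pmf p"] by simp
    then have "Measurable.pred (PiM {v} (\<lambda>_. measure_pmf p)) (\<lambda>N. N v = k)" by measurable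
    then show ?thesis by (simp add: 0 K_def R_def pred_def)
  next
    case (Suc i)
    then show ?thesis using meas[of i "K j"] by (simp add: K_def R_def pred_def)
  qed
  have R_restrict: "R j (restrict N (K j)) \<longleftrightarrow> R j N" for j N
    using local[of "j - 1" "restrict N (K j)" N] by (auto simp: R_def K_def split: nat.splits)
  have "GW.indep_events (\<lambda>j. {N. R j N}) {..k}"
    using GW.indep_eventsI_indep_vars[OF indep R_sets] by (simp add: R_restrict space_galton_watson)
  then have "GW.prob (\<Inter>j\<in>{..k}. {N. R j N}) = (\<Prod>j\<in>{..k}. GW.prob {N. R j N})"
    by (auto simp: GW.indep_events_def)
  moreover have "(\<Inter>j\<in>{..k}. {N. R j N}) = {N. N v = k \<and> (\<forall>i<k. Q i N)}"
    by (auto simp: R_def split: nat.splits)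
  moreover have "(\<Prod>j\<in>{..k}. GW.prob {N. R j N}) = pmf p k * q ^ k"
    by (simp add: prod.atMost_shift R_def prob_offspring prob_Q)
  ultimately show ?thesis by simp
qed

text \<open>The event splits according to the number of children, and the sum over that number is
  the generating function.\<close>

lemma prob_all_children:
  assumes meas: "\<And>K i. descendants (v @ [i]) \<subseteq> K \<Longrightarrow> Measurable.pred (PiM K (\<lambda>_. measure_pmf p)) (Q i)"
    and local: "\<And>i N N'. (\<And>u. u \<in> descendants (v @ [i]) \<Longrightarrow> N u = N' u) \<Longrightarrow> Q i N \<longleftrightarrow> Q i N'"
    and prob_Q: "\<And>i. GW.prob {N. Q i N} = q"
  shows "GW.prob {N. \<forall>i<N v. Q i N} = pgf p q" "{N. \<forall>i<N v. Q i N} \<in> sets (galton_watson p)"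
proof -
  have Q_sets: "{N. Q i N} \<in> sets (galton_watson p)" for i
    using meas[of i UNIV] by (simp add: pred_def galton_watson_def space_PiM)
  have sets: "{N. N v = k \<and> (\<forall>i<k. Q i N)} \<in> sets (galton_watson p)" for k
  proof -
    have "{N. N v = k \<and> (\<forall>i<k. Q i N)} = {N. N v = k} \<inter> (space (galton_watson p) \<inter> (\<Inter>i\<in>{..<k}. {N. Q i N}))"
      by (auto simp: space_galton_watson)
    also have "\<dots> \<in> sets (galton_watson p)"
      using Q_sets offspring_sets by (cases "k = 0") (auto simp: lessThan_empty_iff)
    finally show ?thesis .
  qed
  have Un: "{N. \<forall>i<N v. Q i N} = (\<Union>k. {N. N v = k \<and> (\<forall>i<k. Q i N)})" by auto
  show "{N. \<forall>i<N v. Q i N} \<in> sets (galton_watson p)" unfolding Un using sets by blast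
  have "(\<lambda>k. GW.prob {N. N v = k \<and> (\<forall>i<k. Q i N)}) sums GW.prob {N. \<forall>i<N v. Q i N}"
    unfolding Un by (rule GW.finite_measure_UNION) (use sets in \<open>auto simp: disjoint_family_on_def\<close>)
  moreover have "(\<lambda>k. pmf p k * q ^ k) sums pgf p q"
    by (rule pgf_sums) (use prob_Q[of 0] in auto)
  moreover have "GW.prob {N. N v = k \<and> (\<forall>i<k. Q i N)} = pmf p k * q ^ k" for k
    by (rule prob_children[OF meas local prob_Q])
  ultimately show "GW.prob {N. \<forall>i<N v. Q i N} = pgf p q" by (simp add: sums_unique2)
qed

end

section \<open>The value of the game\<close>

text \<open>The term \<open>1 - pgf p (1 - forced_prob c p n)\<close> is the probability that some
  child is won. It does not count childless vertices, which are added separately when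
  \<open>c\<close> holds.\<close>

fun forced_prob :: "bool \<Rightarrow> nat pmf \<Rightarrow> nat \<Rightarrow> real"
  and can_force_prob :: "bool \<Rightarrow> nat pmf \<Rightarrow> nat \<Rightarrow> real" where
  "forced_prob c p 0 = 0"
| "forced_prob c p (Suc n) = pgf p (can_force_prob c p n)"
| "can_force_prob c p 0 = 0"
| "can_force_prob c p (Suc n) = (if c then pmf p 0 else 0) + 1 - pgf p (1 - forced_prob c p n)"

lemma prob_forced:
  "measure (galton_watson p) {N. forced c n N v} = forced_prob c p n \<and>
   measure (galton_watson p) {N. can_force c n N v} = can_force_prob c p n"
proof (induction n arbitrary: v)
  case 0
  show ?case by simp
next
  case (Suc n)
  interpret prob_space "galton_watson p" by (rule prob_space_galton_watson)
  have "prob {N. \<not> forced c n N (v @ [i])} = 1 - forced_prob c p n" for i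
    using prob_neg[of "\<lambda>N. forced c n N (v @ [i])"] forced_sets(1)[of c n "v @ [i]" p] Suc.IH
    by (simp add: space_galton_watson)
  then have no_forced: "prob {N. \<forall>i<N v. \<not> forced c n N (v @ [i])} = pgf p (1 - forced_prob c p n)"
    and no_forced_sets: "{N. \<forall>i<N v. \<not> forced c n N (v @ [i])} \<in> events"
    using forced_measurable forced_cong
    by (intro prob_all_children[of v "\<lambda>i N. \<not> forced c n N (v @ [i])"] pred_intros_logic;
        blast)+
  have "prob {N. forced c (Suc n) N v} = forced_prob c p (Suc n)"
    unfolding forced.simps forced_prob.simps using forced_measurable forced_cong Suc.IH
    by (intro prob_all_children(1)) blast+
  moreover have "prob {N. can_force c (Suc n) N v} = can_force_prob c p (Suc n)"
  proof -
    \<comment> \<open>A childless vertex vacuously has no won child, so the two parts of the union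
      are disjoint.\<close>
    have eq: "{N. can_force c (Suc n) N v} = {N. c \<and> N v = 0} \<union>
        (space (galton_watson p) - {N. \<forall>i<N v. \<not> forced c n N (v @ [i])})"
      by (auto simp: space_galton_watson)
    have "prob {N. can_force c (Suc n) N v} = prob {N. c \<and> N v = 0} +
        prob (space (galton_watson p) - {N. \<forall>i<N v. \<not> forced c n N (v @ [i])})"
      unfolding eq using offspring_sets[of v 0 p] no_forced_sets
      by (intro finite_measure_Union) (cases c; auto)+
    then show ?thesis
      using prob_compl[OF no_forced_sets] no_forced prob_offspring[of p v 0] by (cases c) simp_all
  qed
  ultimately show ?case by blast
qed

lemma forced_prob_bounds:
  "forced_prob c p n \<in> {0..1}" "can_force_prob c p n \<in> {0..1}"
  using prob_forced[of p c n "[]"] prob_space.prob_le_1[OF prob_space_galton_watson]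
  by (metis atLeastAtMost_iff measure_nonneg)+

lemma forced_prob_tendsto:
  "forced_prob c p \<longlonglongrightarrow> measure (galton_watson p) {N. \<exists>n. forced c n N []}"
  "can_force_prob c p \<longlonglongrightarrow> measure (galton_watson p) {N. \<exists>n. can_force c n N []}"
proof -
  interpret prob_space "galton_watson p" by (rule prob_space_galton_watson)
  have "(\<lambda>n. prob {N. forced c n N []}) \<longlonglongrightarrow> prob (\<Union>n. {N. forced c n N []})"
    "(\<lambda>n. prob {N. can_force c n N []}) \<longlonglongrightarrow> prob (\<Union>n. {N. can_force c n N []})"
    using forced_sets forced_mono can_force_mono
    by (intro finite_Lim_measure_incseq; auto simp: incseq_def)+
  then show "forced_prob c p \<longlonglongrightarrow> prob {N. \<exists>n. forced c n N []}"
    "can_force_prob c p \<longlonglongrightarrow> prob {N. \<exists>n. can_force c n N []}"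
    by (simp_all add: prob_forced Collect_ex_eq)
qed

text \<open>The recursion is monotone and starts at \<open>0\<close>, so it cannot pass a pair that
  it does not increase.\<close>

lemma forced_prob_le:
  assumes "0 \<le> a" "a \<le> 1" "0 \<le> b" "b \<le> 1"
    and "pgf p b \<le> a" "(if c then pmf p 0 else 0) + 1 - pgf p (1 - a) \<le> b"
  shows "forced_prob c p n \<le> a \<and> can_force_prob c p n \<le> b"
proof (induction n)
  case (Suc n)
  have "pgf p (can_force_prob c p n) \<le> pgf p b"
    by (rule pgf_mono) (use Suc forced_prob_bounds[of c p n] assms in auto)
  moreover have "pgf p (1 - a) \<le> pgf p (1 - forced_prob c p n)"
    by (rule pgf_mono) (use Suc forced_prob_bounds[of c p n] assms in auto)
  ultimately show ?case using assms(5,6) by simp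
qed (use assms in simp)

text \<open>By continuity of the generating function the recursion passes to the limit, and the
  limit is the least solution because every iterate lies below every supersolution.\<close>

lemma game_value:
  fixes p :: "nat pmf" and c :: bool
  defines "a \<equiv> measure (galton_watson p) {N. \<exists>n. forced c n N []}"
    and "b \<equiv> measure (galton_watson p) {N. \<exists>n. can_force c n N []}"
  shows "a = pgf p b" "b = (if c then pmf p 0 else 0) + 1 - pgf p (1 - a)"
    and "0 \<le> a" "a \<le> 1" "0 \<le> b" "b \<le> 1"
    and "\<lbrakk>0 \<le> a'; a' \<le> 1; 0 \<le> b'; b' \<le> 1; pgf p b' \<le> a';
          (if c then pmf p 0 else 0) + 1 - pgf p (1 - a') \<le> b'\<rbrakk> \<Longrightarrow> a \<le> a' \<and> b \<le> b'"
proof -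
  note lim = forced_prob_tendsto[of c p, folded a_def b_def]
  show "a = pgf p b"
  proof (rule LIMSEQ_unique)
    show "(\<lambda>n. forced_prob c p (Suc n)) \<longlonglongrightarrow> a" using lim(1) by (rule LIMSEQ_Suc)
    show "(\<lambda>n. forced_prob c p (Suc n)) \<longlonglongrightarrow> pgf p b"
      unfolding forced_prob.simps
      using lim(2) forced_prob_bounds[of c p] by (intro tendsto_pgf) auto
  qed
  show "b = (if c then pmf p 0 else 0) + 1 - pgf p (1 - a)"
  proof (rule LIMSEQ_unique)
    show "(\<lambda>n. can_force_prob c p (Suc n)) \<longlonglongrightarrow> b" using lim(2) by (rule LIMSEQ_Suc)
    show "(\<lambda>n. can_force_prob c p (Suc n)) \<longlonglongrightarrow> (if c then pmf p 0 else 0) + 1 - pgf p (1 - a)"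
      unfolding can_force_prob.simps
      using lim(1) forced_prob_bounds[of c p] by (intro tendsto_intros tendsto_pgf) auto
  qed
  show "0 \<le> a" "a \<le> 1" "0 \<le> b" "b \<le> 1"
    unfolding a_def b_def using prob_space.prob_le_1[OF prob_space_galton_watson] by auto
  show "a \<le> a' \<and> b \<le> b'"
    if "0 \<le> a'" "a' \<le> 1" "0 \<le> b'" "b' \<le> 1" "pgf p b' \<le> a'"
      "(if c then pmf p 0 else 0) + 1 - pgf p (1 - a') \<le> b'"
    using LIMSEQ_le_const2[OF lim(1)] LIMSEQ_le_const2[OF lim(2)] forced_prob_le[OF that] by blast
qed

section \<open>Draw and escape probabilities as extremal fixed points\<close>

text \<open>
  Here \<open>w\<close> is the probability that the first player wins and \<open>1 - x\<close> that the second one does;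
  \<open>{w, x}\<close> is a \<open>2\<close>-cycle of the map \<open>z \<mapsto> 1 - pgf p z\<close>.
\<close>

definition two_cycle :: "nat pmf \<Rightarrow> real \<Rightarrow> real \<Rightarrow> bool" where
  "two_cycle p w x \<longleftrightarrow> 0 \<le> w \<and> w \<le> x \<and> x \<le> 1 \<and> x = 1 - pgf p w \<and> w = 1 - pgf p x"

lemma ex_forced_sets:
  "{N. \<exists>n. forced c n N v} \<in> sets (galton_watson p)"
  "{N. \<exists>n. can_force c n N v} \<in> sets (galton_watson p)"
  unfolding Collect_ex_eq using forced_sets by blast+

text \<open>With \<open>w = b\<close> and \<open>x = 1 - a\<close> the least solution
  \<open>(a, b)\<close> becomes the pair with least \<open>w\<close> and greatest \<open>x\<close>.
  The order \<open>w \<le> x\<close> holds because the players cannot both have a winning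
  strategy.\<close>

lemma draw_prob_two_cycle:
  obtains w x where "two_cycle p w x" "draw_prob p = x - w"
    "\<And>w' x'. \<lbrakk>0 \<le> w'; w' \<le> 1; 0 \<le> x'; x' \<le> 1; x' \<le> 1 - pgf p w'; 1 - pgf p x' \<le> w'\<rbrakk>
       \<Longrightarrow> w \<le> w' \<and> x' \<le> x"
proof -
  interpret prob_space "galton_watson p" by (rule prob_space_galton_watson)
  let ?A = "{N. \<exists>n. forced False n N []}" and ?B = "{N. \<exists>n. can_force False n N []}"
  define a b where ab: "a = prob ?A" "b = prob ?B"
  note gv = game_value[where c = False and p = p, folded ab, simplified]
  have "prob (?A \<union> ?B) = a + b"
    unfolding ab by (rule finite_measure_Union) (use ex_forced_sets not_forced_and_can_force in blast)+
  moreover have "draw_prob p = prob (space (galton_watson p) - (?A \<union> ?B))"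
    unfolding draw_prob_def normal_draw_def first_has_winning_strategy_iff
      second_has_winning_strategy_iff
    by (rule arg_cong[where f = prob]) auto
  moreover have "\<dots> = 1 - prob (?A \<union> ?B)" by (intro prob_compl sets.Un ex_forced_sets)
  ultimately have draw: "draw_prob p = (1 - a) - b" "0 \<le> (1 - a) - b"
    using prob_le_1[of "?A \<union> ?B"] by linarith+
  show thesis
  proof (rule that)
    show "two_cycle p b (1 - a)" unfolding two_cycle_def using gv(1-6) draw(2) by (intro conjI; linarith)
    show "draw_prob p = (1 - a) - b" by fact
    show "b \<le> w' \<and> x' \<le> 1 - a"
      if "0 \<le> w'" "w' \<le> 1" "0 \<le> x'" "x' \<le> 1" "x' \<le> 1 - pgf p w'" "1 - pgf p x' \<le> w'" for w' x'
      using gv(7)[of "1 - x'" w'] that by simp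
  qed
qed

text \<open>Complementing the least solution for Stopper gives the greatest one for Escaper;
  \<open>y\<close> is the probability that Escaper wins when moving second.\<close>

lemma escape_prob1_fixed_point:
  obtains y where "escape_prob1 p \<in> {0..1}" "y = pgf p (escape_prob1 p) - pmf p 0"
    "escape_prob1 p = 1 - pgf p (1 - y)"
    "\<And>x' y'. \<lbrakk>0 \<le> x'; x' \<le> 1; y' = pgf p x' - pmf p 0; x' = 1 - pgf p (1 - y')\<rbrakk>
       \<Longrightarrow> x' \<le> escape_prob1 p"
proof -
  interpret prob_space "galton_watson p" by (rule prob_space_galton_watson)
  let ?A = "{N. \<exists>n. forced True n N []}"
  define a b where ab: "a = prob ?A" "b = prob {N. \<exists>n. can_force True n N []}"
  note gv = game_value[where c = True and p = p, folded ab, simplified]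
  have "escape_prob1 p = prob (space (galton_watson p) - ?A)"
    unfolding escape_prob1_def stopper_has_winning_strategy_iff
    by (rule arg_cong[where f = prob]) auto
  also have "\<dots> = 1 - a" unfolding ab by (rule prob_compl) (rule ex_forced_sets)
  finally have escape: "escape_prob1 p = 1 - a" .
  show thesis
  proof (rule that)
    show "escape_prob1 p \<in> {0..1}" unfolding escape using gv(3,4) by simp
    show "1 - b = pgf p (escape_prob1 p) - pmf p 0" unfolding escape using gv(2) by linarith
    show "escape_prob1 p = 1 - pgf p (1 - (1 - b))" unfolding escape using gv(1) by simp
    show "x' \<le> escape_prob1 p"
      if "0 \<le> x'" "x' \<le> 1" "y' = pgf p x' - pmf p 0" "x' = 1 - pgf p (1 - y')" for x' y'
    proof -
      have "a \<le> 1 - x' \<and> b \<le> 1 - y'"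
      proof (rule gv(7))
        show "0 \<le> 1 - y'" "1 - y' \<le> 1"
          using pgf_bounds[OF that(1,2), of p] pmf_nonneg[of p 0] unfolding that(3) by linarith+
        show "pgf p (1 - y') \<le> 1 - x'" using that(4) by linarith
        show "pmf p 0 + 1 - pgf p (1 - (1 - x')) \<le> 1 - y'" unfolding that(3) by simp
      qed (use that(1,2) in simp_all)
      then show ?thesis unfolding escape by linarith
    qed
  qed
qed

text \<open>Every cycle is admissible in the extremality property, so the extremal pair encloses
  it.\<close>

lemma draw_prob_pos_iff: "0 < draw_prob p \<longleftrightarrow> (\<exists>w x. two_cycle p w x \<and> w < x)"
proof -
  obtain w x where "two_cycle p w x" "draw_prob p = x - w"
    and ext: "\<And>w' x'. \<lbrakk>0 \<le> w'; w' \<le> 1; 0 \<le> x'; x' \<le> 1; x' \<le> 1 - pgf p w'; 1 - pgf p x' \<le> w'\<rbrakk>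
       \<Longrightarrow> w \<le> w' \<and> x' \<le> x"
    by (rule draw_prob_two_cycle[of p]) blast
  moreover have "w < x" if "two_cycle p w' x'" "w' < x'" for w' x'
    using ext[of w' x'] that unfolding two_cycle_def by linarith
  ultimately show ?thesis by auto
qed

lemma draw_prob_eq_gap:
  assumes "two_cycle p w x" "w < x" "x - w = d"
    and "\<And>w x. two_cycle p w x \<Longrightarrow> w < x \<Longrightarrow> x - w = d"
  shows "draw_prob p = d"
proof -
  obtain w' x' where *: "two_cycle p w' x'" "draw_prob p = x' - w'"
    by (rule draw_prob_two_cycle[of p])
  moreover have "0 < draw_prob p" using assms draw_prob_pos_iff by blast
  ultimately show ?thesis using assms(4) by simp
qed

lemma draw_prob_bounds: "0 \<le> draw_prob p" "draw_prob p \<le> 1 - pmf p 0"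
proof -
  obtain w x where "two_cycle p w x" "draw_prob p = x - w"
    by (rule draw_prob_two_cycle[of p])
  then show "0 \<le> draw_prob p" "draw_prob p \<le> 1 - pmf p 0"
    using pgf_bounds(1)[of w p] unfolding two_cycle_def by linarith+
qed

text \<open>If the generating function vanishes at \<open>0\<close>, the pair \<open>(0, 1)\<close>
  is admissible, and no pair is wider.\<close>

lemma draw_prob_eq_1:
  assumes "pmf p 0 = 0"
  shows "draw_prob p = 1"
proof -
  obtain w x where wx: "two_cycle p w x" "draw_prob p = x - w"
    and ext: "\<And>w' x'. \<lbrakk>0 \<le> w'; w' \<le> 1; 0 \<le> x'; x' \<le> 1; x' \<le> 1 - pgf p w'; 1 - pgf p x' \<le> w'\<rbrakk>
       \<Longrightarrow> w \<le> w' \<and> x' \<le> x"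
    by (rule draw_prob_two_cycle[of p]) blast
  have "w \<le> 0 \<and> 1 \<le> x" by (rule ext) (simp_all add: pgf_0 pgf_1 assms)
  then show ?thesis using wx unfolding two_cycle_def by linarith
qed

section \<open>Explicit families\<close>

text \<open>One law on \<open>{0, 1, 2, 3, 16}\<close> contains the families of all three
  constructions.\<close>

definition offspring_pmf :: "real \<Rightarrow> real \<Rightarrow> real \<Rightarrow> real \<Rightarrow> nat pmf" where
  "offspring_pmf a b c d = embed_pmf (\<lambda>i. if i = 0 then 1 - a - b - c - d else if i = 1 then a
     else if i = 2 then b else if i = 3 then c else if i = 16 then d else 0)"

definition subprob :: "real \<Rightarrow> real \<Rightarrow> real \<Rightarrow> real \<Rightarrow> bool" where
  "subprob a b c d \<longleftrightarrow> 0 \<le> a \<and> 0 \<le> b \<and> 0 \<le> c \<and> 0 \<le> d \<and> a + b + c + d \<le> 1"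

lemma pmf_offspring_pmf:
  assumes "subprob a b c d"
  shows "pmf (offspring_pmf a b c d) i = (if i = 0 then 1 - a - b - c - d else if i = 1 then a
     else if i = 2 then b else if i = 3 then c else if i = 16 then d else 0)"
  unfolding offspring_pmf_def
proof (rule pmf_embed_pmf)
  let ?f = "\<lambda>i :: nat. if i = 0 then 1 - a - b - c - d else if i = 1 then a
     else if i = 2 then b else if i = 3 then c else if i = 16 then d else 0"
  show nonneg: "0 \<le> ?f i" for i using assms by (auto simp: subprob_def)
  have "(\<integral>\<^sup>+i. ennreal (?f i) \<partial>count_space UNIV) = (\<Sum>i\<in>{0,1,2,3,16}. ennreal (?f i))"
    by (rule nn_integral_count_space') auto
  also have "\<dots> = ennreal (\<Sum>i\<in>{0,1,2,3,16}. ?f i)"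
    by (rule sum_ennreal) (rule nonneg)
  finally show "(\<integral>\<^sup>+i. ennreal (?f i) \<partial>count_space UNIV) = 1" by simp
qed

lemma pgf_offspring_pmf:
  assumes "subprob a b c d"
  shows "pgf (offspring_pmf a b c d) x = 1 - a - b - c - d + a * x + b * x^2 + c * x^3 + d * x^16"
proof -
  have "pgf (offspring_pmf a b c d) x = (\<Sum>k\<in>{0,1,2,3,16}. pmf (offspring_pmf a b c d) k * x ^ k)"
    unfolding pgf_def by (rule suminf_finite) (auto simp: pmf_offspring_pmf[OF assms])
  then show ?thesis by (simp add: pmf_offspring_pmf[OF assms] algebra_simps)
qed

lemma offspring_family:
  assumes "\<And>t. t \<in> {0<..<1} \<Longrightarrow> subprob (a t) (b t) (c t) (d t)"
    and cont: "continuous_on {0<..<1} a" "continuous_on {0<..<1} b"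
      "continuous_on {0<..<1} c" "continuous_on {0<..<1} d"
  shows "bounded_support_family (\<lambda>t. offspring_pmf (a t) (b t) (c t) (d t))"
    and "continuous_family (\<lambda>t. offspring_pmf (a t) (b t) (c t) (d t))"
proof -
  let ?p = "\<lambda>t. offspring_pmf (a t) (b t) (c t) (d t)"
  note pmf = pmf_offspring_pmf[OF assms(1)]
  show "bounded_support_family ?p"
    unfolding bounded_support_family_def by (rule exI[of _ 16]) (simp add: pmf)
  show "continuous_family ?p"
    unfolding continuous_family_def
  proof
    fix t :: real assume t: "t \<in> {0<..<1}"
    let ?F = "at t within {0<..<1}"
    have dist: "l1_dist (?p s) (?p t) = (\<Sum>i\<in>{0,1,2,3,16}. \<bar>pmf (?p s) i - pmf (?p t) i\<bar>)"
      if "s \<in> {0<..<1}" for s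
      unfolding l1_dist_def by (rule suminf_finite) (simp_all add: pmf[OF that] pmf[OF t])
    have lim: "(a \<longlongrightarrow> a t) ?F" "(b \<longlongrightarrow> b t) ?F" "(c \<longlongrightarrow> c t) ?F" "(d \<longlongrightarrow> d t) ?F"
      using cont t by (auto simp: continuous_on_def)
    have "((\<lambda>s. \<bar>(1 - a s - b s - c s - d s) - (1 - a t - b t - c t - d t)\<bar> + \<bar>a s - a t\<bar>
        + \<bar>b s - b t\<bar> + \<bar>c s - c t\<bar> + \<bar>d s - d t\<bar>) \<longlongrightarrow>
      \<bar>(1 - a t - b t - c t - d t) - (1 - a t - b t - c t - d t)\<bar> + \<bar>a t - a t\<bar>
        + \<bar>b t - b t\<bar> + \<bar>c t - c t\<bar> + \<bar>d t - d t\<bar>) ?F"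
      by (intro tendsto_intros lim)
    moreover have "\<forall>\<^sub>F s in ?F. \<bar>(1 - a s - b s - c s - d s) - (1 - a t - b t - c t - d t)\<bar>
        + \<bar>a s - a t\<bar> + \<bar>b s - b t\<bar> + \<bar>c s - c t\<bar> + \<bar>d s - d t\<bar> = l1_dist (?p s) (?p t)"
      unfolding eventually_at_filter by (rule always_eventually) (simp add: dist pmf pmf[OF t])
    ultimately show "((\<lambda>s. l1_dist (?p s) (?p t)) \<longlongrightarrow> 0) ?F"
      using tendsto_cong by force
  qed
qed

subsection \<open>A discontinuous transition\<close>

abbreviation (input) gap_poly :: "real \<Rightarrow> real" where
  "gap_poly x \<equiv> (x^2 + x^16) / 2"

abbreviation discontinuous_pmf :: "real \<Rightarrow> nat pmf" where
  "discontinuous_pmf s \<equiv> offspring_pmf 0 (s / 2) 0 (s / 2)"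

lemma subprob_discontinuous: "0 \<le> s \<Longrightarrow> s \<le> 1 \<Longrightarrow> subprob 0 (s / 2) 0 (s / 2)"
  by (simp add: subprob_def)

lemma two_cycle_discontinuous_iff:
  assumes "0 \<le> s" "s \<le> 1"
  shows "two_cycle (discontinuous_pmf s) w x \<longleftrightarrow>
    0 \<le> w \<and> w \<le> x \<and> x \<le> 1 \<and> x = s * (1 - gap_poly w) \<and> w = s * (1 - gap_poly x)"
proof -
  have "1 - pgf (discontinuous_pmf s) z = s * (1 - gap_poly z)" for z
    unfolding pgf_offspring_pmf[OF subprob_discontinuous[OF assms]] by (simp add: field_simps)
  then show ?thesis by (simp only: two_cycle_def)
qed

text \<open>
  The fixed point of \<open>z \<mapsto> s * (1 - gap_poly z)\<close> is at most \<open>3/4\<close>, whereas by the mean value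
  theorem the slope of \<open>s * gap_poly\<close> equals \<open>1\<close> somewhere between the two points of a cycle,
  which happens only beyond \<open>31/40\<close>. So a cycle cannot shrink to the fixed point.
\<close>

lemma two_cycle_separated:
  assumes s: "0 \<le> s" "s \<le> 1" and cyc: "two_cycle (discontinuous_pmf s) w x" "w < x"
  shows "w \<le> 3/4" "31/40 \<le> x"
proof -
  have eq: "0 \<le> w" "x = s * (1 - gap_poly w)" "w = s * (1 - gap_poly x)" "x \<le> 1"
    using cyc(1) two_cycle_discontinuous_iff[OF s] by blast+
  show "w \<le> 3/4"
  proof (rule ccontr)
    \<comment> \<open>Both points would exceed \<open>3/4\<close>, but \<open>gap_poly\<close> is
      above \<open>1/4\<close> there, which pushes the image \<open>w\<close> of \<open>x\<close>
      below \<open>3/4\<close>.\<close>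
    assume "\<not> w \<le> 3/4"
    then have x: "3/4 \<le> x" using cyc(2) by simp
    have "(3/4)^2 \<le> x^2" "(3/4)^16 \<le> x^16" using x by (auto intro: power_mono)
    then have "1 - gap_poly x \<le> 3/4" by (simp add: power_numeral_reduce)
    moreover have "0 \<le> 1 - gap_poly x" using x eq(4) power_le_one[of x 2] power_le_one[of x 16] by simp
    ultimately have "s * (1 - gap_poly x) \<le> 3/4" using s mult_left_le_one_le[of "1 - gap_poly x" s] by linarith
    then show False using eq(3) \<open>\<not> w \<le> 3/4\<close> by linarith
  qed
  show "31/40 \<le> x"
  proof (rule ccontr)
    assume "\<not> 31/40 \<le> x"
    have "\<exists>z. w < z \<and> z < x \<and> gap_poly x - gap_poly w = (x - w) * (z + 8 * z^15)"
      by (rule MVT2[OF cyc(2)]) (auto intro!: derivative_eq_intros)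
    then obtain z where z: "w < z" "z < x" "gap_poly x - gap_poly w = (x - w) * (z + 8 * z^15)"
      by blast
    have "z^15 \<le> (31/40)^15" using z eq(1) \<open>\<not> 31/40 \<le> x\<close> by (intro power_mono) auto
    \<comment> \<open>At \<open>31/40\<close> the derivative of \<open>gap_poly\<close> is about
      0.95.\<close>
    then have lt1: "z + 8 * z^15 < 1" using z(2) \<open>\<not> 31/40 \<le> x\<close> by (simp add: power_numeral_reduce)
    have "x - w = s * (gap_poly x - gap_poly w)" using eq(2,3) by argo
    also have "\<dots> \<le> gap_poly x - gap_poly w"
      using s z eq(1) cyc(2) by (intro mult_left_le_one_le) auto
    also have "\<dots> < x - w" unfolding z(3) using lt1 cyc(2) by simp
    finally show False by simp
  qed
qed

lemma draw_prob_discontinuous_pos: "0 < draw_prob (discontinuous_pmf (999/1000))"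
proof -
  let ?p = "discontinuous_pmf (999/1000)"
  obtain w x where wx: "two_cycle ?p w x" "draw_prob ?p = x - w"
    and ext: "\<And>w' x'. \<lbrakk>0 \<le> w'; w' \<le> 1; 0 \<le> x'; x' \<le> 1; x' \<le> 1 - pgf ?p w'; 1 - pgf ?p x' \<le> w'\<rbrakk>
       \<Longrightarrow> w \<le> w' \<and> x' \<le> x"
    by (rule draw_prob_two_cycle[of ?p]) blast
  \<comment> \<open>The map \<open>1 - pgf ?p z\<close> is about 0.998 at \<open>1/20\<close> and
    about 0.026 at \<open>997/1000\<close>, so this pair is admissible with room to spare.\<close>
  have "w \<le> 1/20 \<and> 997/1000 \<le> x"
    by (rule ext; simp add: pgf_offspring_pmf subprob_def power_numeral_reduce)
  then show ?thesis using wx(2) by simp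
qed

lemma discontinuous_transition:
  "\<exists>p :: real \<Rightarrow> nat pmf. bounded_support_family p \<and> continuous_family p \<and>
      (\<exists>t\<^sub>c\<in>{0<..<1}.
         (\<forall>t\<in>{0<..<1}. t < t\<^sub>c \<longrightarrow> draw_prob (p t) = 0) \<and>
         (\<forall>t\<in>{0<..<1}. t \<ge> t\<^sub>c \<longrightarrow> draw_prob (p t) \<in> {0<..<1}) \<and>
         pmf (p t\<^sub>c) 1 < 1)"
proof -
  \<comment> \<open>The closed conditions \<open>w \<le> 3/4\<close> and
    \<open>31/40 \<le> x\<close> replace \<open>w < x\<close>. By the separation they lose no cycle,
    and they make the set compact.\<close>
  define C :: "(real \<times> real \<times> real) set" where
    "C = {(s, w, x). s \<in> {0..999/1000} \<and> w \<in> {0..3/4} \<and> x \<in> {31/40..1} \<and>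
       x = s * (1 - gap_poly w) \<and> w = s * (1 - gap_poly x)}"
  have C_iff: "s \<in> fst ` C \<longleftrightarrow> 0 < draw_prob (discontinuous_pmf s)" if "0 \<le> s" "s \<le> 999/1000" for s
  proof -
    have s: "0 \<le> s" "s \<le> 1" using that by auto
    show ?thesis unfolding draw_prob_pos_iff
    proof
      assume "s \<in> fst ` C"
      then obtain w x where "(s, w, x) \<in> C" by auto
      then have "two_cycle (discontinuous_pmf s) w x \<and> w < x"
        unfolding C_def two_cycle_discontinuous_iff[OF s] mem_Collect_eq prod.case atLeastAtMost_iff
        by linarith
      then show "\<exists>w x. two_cycle (discontinuous_pmf s) w x \<and> w < x" by blast
    next
      assume "\<exists>w x. two_cycle (discontinuous_pmf s) w x \<and> w < x"
      then obtain w x where wx: "two_cycle (discontinuous_pmf s) w x" "w < x" by blast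
      then have "(s, w, x) \<in> C"
        using two_cycle_separated[OF s wx] wx(1) that
        unfolding C_def two_cycle_discontinuous_iff[OF s] mem_Collect_eq prod.case atLeastAtMost_iff
        by blast
      then show "s \<in> fst ` C" by force
    qed
  qed
  have C_eq: "C = ({0..999/1000} \<times> {0..3/4} \<times> {31/40..1}) \<inter>
      {z. snd (snd z) = fst z * (1 - gap_poly (fst (snd z)))} \<inter>
      {z. fst (snd z) = fst z * (1 - gap_poly (snd (snd z)))}"
    unfolding C_def by (simp only: set_eq_iff Int_iff mem_Collect_eq mem_Times_iff case_prod_unfold) blast
  have "compact C"
    unfolding C_eq
    by (intro compact_Int_closed compact_Times compact_Icc closed_Collect_eq continuous_intros) simp_all
  then have "compact (fst ` C)"
    by (intro compact_continuous_image continuous_intros)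
  moreover have "999/1000 \<in> fst ` C" using C_iff[of "999/1000"] draw_prob_discontinuous_pos by simp
  ultimately obtain s0 where s0: "s0 \<in> fst ` C" "\<And>s. s \<in> fst ` C \<Longrightarrow> s0 \<le> s"
    using compact_attains_inf[of "fst ` C"] by blast
  have s0_range: "0 < s0" "s0 \<le> 999/1000"
  proof -
    obtain w x where "(s0, w, x) \<in> C" using s0(1) by auto
    then have *: "0 \<le> s0" "s0 \<le> 999/1000" "31/40 \<le> x" "x = s0 * (1 - gap_poly w)"
      unfolding C_def mem_Collect_eq prod.case atLeastAtMost_iff by blast+
    then have "s0 \<noteq> 0" by fastforce
    then show "0 < s0" "s0 \<le> 999/1000" using * by linarith+
  qed
  \<comment> \<open>The parameter reaches the least value with draws at \<open>t = 1/2\<close> and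
    stays there.\<close>
  define \<sigma> where "\<sigma> t = s0 * min 1 (2 * t)" for t
  have \<sigma>: "0 < \<sigma> t" "\<sigma> t \<le> 999/1000" if "t \<in> {0<..<1}" for t
  proof -
    have "0 < min 1 (2 * t)" "min 1 (2 * t) \<le> 1" using that by auto
    then have "0 < \<sigma> t" "\<sigma> t \<le> s0"
      unfolding \<sigma>_def using s0_range(1) by (auto intro: mult_pos_pos mult_left_le)
    then show "0 < \<sigma> t" "\<sigma> t \<le> 999/1000" using s0_range(2) by linarith+
  qed
  have sub: "subprob 0 (\<sigma> t / 2) 0 (\<sigma> t / 2)" if "t \<in> {0<..<1}" for t
    by (rule subprob_discontinuous) (use \<sigma>[OF that] in linarith)+
  have below: "draw_prob (discontinuous_pmf (\<sigma> t)) = 0" if "t \<in> {0<..<1}" "t < 1/2" for t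
  proof -
    have "\<sigma> t < s0" using that s0_range(1) unfolding \<sigma>_def by simp
    then have "\<not> 0 < draw_prob (discontinuous_pmf (\<sigma> t))"
      using s0(2)[of "\<sigma> t"] C_iff[of "\<sigma> t"] \<sigma>[OF that(1)] by linarith
    then show ?thesis using draw_prob_bounds(1)[of "discontinuous_pmf (\<sigma> t)"] by linarith
  qed
  have above: "draw_prob (discontinuous_pmf (\<sigma> t)) \<in> {0<..<1}" if "t \<in> {0<..<1}" "t \<ge> 1/2" for t
  proof -
    have "\<sigma> t = s0" using that unfolding \<sigma>_def by simp
    \<comment> \<open>Since \<open>s0 \<le> 999/1000\<close>, a childless root has positive
      probability, which keeps the draw probability below \<open>1\<close>.\<close>
    then show ?thesis
      using s0(1) C_iff[of s0] s0_range draw_prob_bounds(2)[of "discontinuous_pmf (\<sigma> t)"] sub[OF that(1)]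
      by (simp add: pmf_offspring_pmf)
  qed
  have "continuous_on {0<..<1} (\<lambda>t. \<sigma> t / 2)" unfolding \<sigma>_def by (intro continuous_intros) auto
  then have "bounded_support_family (\<lambda>t. discontinuous_pmf (\<sigma> t))"
    "continuous_family (\<lambda>t. discontinuous_pmf (\<sigma> t))"
    using offspring_family[of "\<lambda>_. 0" "\<lambda>t. \<sigma> t / 2" "\<lambda>_. 0" "\<lambda>t. \<sigma> t / 2"] sub by auto
  moreover have "pmf (discontinuous_pmf (\<sigma> (1/2))) 1 < 1"
    using sub[of "1/2"] by (simp add: pmf_offspring_pmf)
  moreover have "\<forall>t\<in>{0<..<1}. t < 1/2 \<longrightarrow> draw_prob (discontinuous_pmf (\<sigma> t)) = 0"
    "\<forall>t\<in>{0<..<1}. t \<ge> 1/2 \<longrightarrow> draw_prob (discontinuous_pmf (\<sigma> t)) \<in> {0<..<1}"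
    using below above by blast+
  moreover have "1/2 \<in> {0<..<1 :: real}" by simp
  ultimately show ?thesis by blast
qed

subsection \<open>A continuous transition followed by a jump\<close>

text \<open>Subtracting the two equations and dividing by \<open>x - w\<close> determines the sum of
  the points; adding them then determines the product, and so the gap.\<close>

lemma two_cycle_binary:
  assumes s: "0 < s" "s \<le> 1" and cyc: "two_cycle (offspring_pmf 0 s 0 0) w x" "w < x"
  shows "(x - w)\<^sup>2 = 4 - 3 / s\<^sup>2"
proof -
  have sub: "subprob 0 s 0 0" using s by (simp add: subprob_def)
  have eq: "x = s - s * w\<^sup>2" "w = s - s * x\<^sup>2"
    using cyc(1) unfolding two_cycle_def pgf_offspring_pmf[OF sub] by linarith+
  have "x - w = s * (x - w) * (x + w)" using eq by algebra
  then have "(x - w) * (s * (x + w) - 1) = 0" by argo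
  then have "s * (x + w) = 1" using cyc(2) by simp
  then have sum: "x + w = 1 / s" using s by (simp add: field_simps)
  have "x + w = 2 * s - s * ((x + w)\<^sup>2 - 2 * (x * w))"
    using eq by algebra
  then have "s * (x * w) * 2 = 1 / s + s * (1 / s)\<^sup>2 - 2 * s" unfolding sum by argo
  then have "x * w = 1 / s\<^sup>2 - 1" using s by (simp add: field_simps power2_eq_square)
  moreover have "(x - w)\<^sup>2 = (x + w)\<^sup>2 - 4 * (x * w)" by (simp add: algebra_simps power2_eq_square)
  ultimately show ?thesis unfolding sum by (simp add: field_simps)
qed

lemma draw_prob_binary:
  assumes s: "0 < s" "s \<le> 1"
  shows "draw_prob (offspring_pmf 0 s 0 0) = sqrt (max 0 (4 - 3 / s\<^sup>2))"
proof (cases "4 - 3 / s\<^sup>2 \<le> 0")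
  case True
  have "\<not> 0 < draw_prob (offspring_pmf 0 s 0 0)"
  proof
    assume "0 < draw_prob (offspring_pmf 0 s 0 0)"
    then obtain w x where wx: "two_cycle (offspring_pmf 0 s 0 0) w x" "w < x"
      unfolding draw_prob_pos_iff by blast
    have "0 < (x - w)\<^sup>2" using wx(2) by simp
    then show False using two_cycle_binary[OF s wx] True by linarith
  qed
  then show ?thesis using draw_prob_bounds(1)[of "offspring_pmf 0 s 0 0"] True by simp
next
  case False
  define d where "d = sqrt (4 - 3 / s\<^sup>2)"
  have d: "0 < d" "d\<^sup>2 = 4 - 3 / s\<^sup>2" using False by (simp_all add: d_def)
  \<comment> \<open>The roots of the quadratic with sum \<open>1 / s\<close> and product
    \<open>1 / s\<^sup>2 - 1\<close>, the values forced on a nontrivial cycle.\<close>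
  define w x where wx: "w = (1 / s - d) / 2" "x = (1 / s + d) / 2"
  have sum: "w + x = 1 / s" "w < x" "x - w = d" using d(1) by (simp_all add: wx field_simps)
  have prod: "w * x = 1 / s\<^sup>2 - 1"
  proof -
    have "4 * (w * x) = (w + x)\<^sup>2 - (x - w)\<^sup>2" by algebra
    then show ?thesis unfolding sum(1,3) d(2) by (simp add: power_divide)
  qed
  \<comment> \<open>As \<open>s \<le> 1\<close>, the product of the roots is nonnegative, hence so
    is the smaller root.\<close>
  have "1 \<le> 1 / s\<^sup>2" using s by (simp add: power_le_one)
  then have "0 \<le> w * x" using prod by simp
  moreover have "0 < x" using d(1) s by (simp add: wx add_pos_pos)
  ultimately have "0 \<le> w" by (simp add: zero_le_mult_iff)
  have eq: "x = s - s * w\<^sup>2" "w = s - s * x\<^sup>2"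
  proof -
    have "s * w\<^sup>2 = w * (s * (w + x)) - s * (w * x)" "s * x\<^sup>2 = x * (s * (w + x)) - s * (w * x)"
      by algebra+
    moreover have "s * (w + x) = 1" "s * (w * x) = 1 / s - s"
      unfolding sum(1) prod using s by (simp_all add: field_simps power2_eq_square)
    ultimately have "s * w\<^sup>2 = w - 1 / s + s" "s * x\<^sup>2 = x - 1 / s + s" by simp_all
    then show "x = s - s * w\<^sup>2" "w = s - s * x\<^sup>2" using sum(1) by linarith+
  qed
  have "x \<le> 1" using eq(1) s by (smt (verit) mult_nonneg_nonneg zero_le_power2)
  have sub: "subprob 0 s 0 0" using s by (simp add: subprob_def)
  have "two_cycle (offspring_pmf 0 s 0 0) w x"
    unfolding two_cycle_def pgf_offspring_pmf[OF sub]
    using \<open>0 \<le> w\<close> \<open>w < x\<close> \<open>x \<le> 1\<close> eq by (intro conjI) linarith+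
  then have "draw_prob (offspring_pmf 0 s 0 0) = d"
  proof (rule draw_prob_eq_gap)
    show "w < x" "x - w = d" by fact+
    show "x' - w' = d" if "two_cycle (offspring_pmf 0 s 0 0) w' x'" "w' < x'" for w' x'
      using two_cycle_binary[OF s that] that(2) unfolding d_def by (intro real_sqrt_unique[symmetric]) auto
  qed
  then show ?thesis using False by (simp add: d_def)
qed

text \<open>
  The weight of \<open>3\<close> children is chosen so that the points of the \<open>2\<close>-cycle keep the sum \<open>11/10\<close>
  when the probability \<open>e\<close> of having no child varies. For \<open>e = 0\<close> this is not the extremal cycle,
  which is then \<open>{0, 1}\<close>; for \<open>e > 0\<close> it is the only one.
\<close>

definition cubic_weight :: "real \<Rightarrow> real" where
  "cubic_weight e = 100/231 + e * (100/11)"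

abbreviation cubic_pmf :: "real \<Rightarrow> nat pmf" where
  "cubic_pmf e \<equiv> offspring_pmf (1 - e - cubic_weight e) 0 (cubic_weight e) 0"

lemma subprob_cubic: "0 \<le> e \<Longrightarrow> e \<le> 1/100 \<Longrightarrow> subprob (1 - e - cubic_weight e) 0 (cubic_weight e) 0"
  by (simp add: subprob_def cubic_weight_def)

lemma pgf_cubic:
  assumes "0 \<le> e" "e \<le> 1/100"
  shows "pgf (cubic_pmf e) z = e + (1 - e - cubic_weight e) * z + cubic_weight e * z^3"
  unfolding pgf_offspring_pmf[OF subprob_cubic[OF assms]] by simp

text \<open>The sum of the points of a nontrivial cycle is a root of this cubic. The equation is
  linear in the weight, which is solved for so that \<open>11/10\<close> is a root.\<close>

lemma cubic_weight_root:
  "cubic_weight e * (11/10)^3 - (1 + e + cubic_weight e) * (11/10) + 1 - e = 0"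
  by (simp add: cubic_weight_def field_simps power3_eq_cube)

text \<open>Subtracting the equations expresses \<open>Q\<close> by \<open>S\<close>, and adding
  them yields the cubic for \<open>S\<close>. Splitting off the root \<open>11/10\<close> leaves a
  positive cofactor, so \<open>S\<close>, \<open>Q\<close> and the gap are determined.\<close>

lemma two_cycle_cubic:
  assumes e: "0 < e" "e \<le> 1/100" and cyc: "two_cycle (cubic_pmf e) w x" "w < x"
  shows "(x - w)\<^sup>2 = 4 * (1 + e / cubic_weight e) - 363/100"
proof -
  define c where "c = cubic_weight e"
  have c: "0 < c" using e(1) by (simp add: c_def cubic_weight_def)
  have eq: "0 \<le> w" "x = 1 - (e + (1 - e - c) * w + c * w^3)" "w = 1 - (e + (1 - e - c) * x + c * x^3)"
    using cyc(1) unfolding two_cycle_def pgf_cubic[OF less_imp_le[OF e(1)] e(2)] c_def by blast+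
  define S Q where SQ: "S = w + x" "Q = w * x"
  have "(x - w) * ((1 - e - c) + c * (S\<^sup>2 - Q) - 1) = 0"
    using eq(2,3) unfolding SQ by algebra
  then have "(1 - e - c) + c * (S\<^sup>2 - Q) - 1 = 0" using cyc(2) by (simp only: mult_eq_0_iff) linarith
  then have 1: "c * Q = c * S\<^sup>2 - (e + c)" by (simp add: algebra_simps)
  have "S + 2 * e + (1 - e - c) * S + (c * S^3 - 3 * S * (c * Q)) = 2"
    using eq(2,3) unfolding SQ by algebra
  moreover have "2 * (c * S^3 - (1 + e + c) * S + 1 - e) =
      2 - (S + 2 * e + (1 - e - c) * S + (c * S^3 - 3 * S * (c * Q)))"
    unfolding 1 by (simp add: algebra_simps power2_eq_square power3_eq_cube)
  ultimately have "c * S^3 - (1 + e + c) * S + 1 - e = 0" by simp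
  then have "(S - 11/10) * (c * (S\<^sup>2 + S * (11/10) + (11/10)\<^sup>2) - (1 + e + c)) = 0"
    using cubic_weight_root[of e] unfolding c_def by algebra
  \<comment> \<open>From \<open>0 \<le> Q\<close> and \<open>0 < e\<close> follows
    \<open>1 < S\<close>. Together with \<open>e + c \<le> c * S\<^sup>2\<close> this bounds the
    cofactor below by \<open>21 * e\<close>.\<close>
  moreover have "0 < c * (S\<^sup>2 + S * (11/10) + (11/10)\<^sup>2) - (1 + e + c)"
  proof -
    have "0 \<le> c * Q" using c eq(1) cyc(2) by (simp add: SQ)
    then have S2: "e + c \<le> c * S\<^sup>2" using 1 by simp
    then have "c * 1 < c * S\<^sup>2" using e(1) by linarith
    then have "1\<^sup>2 < S\<^sup>2" using c by simp
    moreover have "0 \<le> S" using eq(1) cyc(2) by (simp add: SQ)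
    ultimately have "1 < S" by (rule power_less_imp_less_base)
    then have "c * (11/10) < c * (S * (11/10))" using c by simp
    then have "e + c + c * (11/10) + c * (11/10)\<^sup>2 < c * (S\<^sup>2 + S * (11/10) + (11/10)\<^sup>2)"
      using S2 by (simp add: distrib_left)
    moreover have "c * (11/10) + c * (11/10)\<^sup>2 = 1 + 21 * e"
      by (simp add: c_def cubic_weight_def power2_eq_square field_simps)
    ultimately show ?thesis using e(1) by linarith
  qed
  ultimately have "S = 11/10" by (metis less_irrefl mult_eq_0_iff right_minus_eq)
  have "Q = S\<^sup>2 - (1 + e / c)" using 1 c by (simp add: field_simps)
  moreover have "(x - w)\<^sup>2 = S\<^sup>2 - 4 * Q" by (simp add: SQ algebra_simps power2_eq_square)
  ultimately show ?thesis unfolding \<open>S = 11/10\<close> c_def by (simp add: power2_eq_square)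
qed

lemma draw_prob_cubic:
  assumes e: "0 < e" "e \<le> 1/100"
  shows "draw_prob (cubic_pmf e) = sqrt (4 * (1 + e / cubic_weight e) - 363/100)"
proof -
  define c where "c = cubic_weight e"
  have c: "2/5 < c" using e(1) by (simp add: c_def cubic_weight_def)
  define d where "d = sqrt (4 * (1 + e / c) - 363/100)"
  \<comment> \<open>The lower bound makes the radicand positive, the upper one the product
    \<open>21/100 - e / c\<close> of the two points.\<close>
  have ec: "0 < e / c" "e / c \<le> 1/10" using e c by (simp_all add: field_simps)
  then have d: "0 < d" "d\<^sup>2 = 4 * (1 + e / c) - 363/100" by (simp_all add: d_def)
  define w x where wx: "w = (11/10 - d) / 2" "x = (11/10 + d) / 2"
  have sum: "w + x = 11/10" "w < x" "x - w = d" using d(1) by (simp_all add: wx field_simps)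
  have "4 * (w * x) = (w + x)\<^sup>2 - (x - w)\<^sup>2" by algebra
  then have prod: "w * x = 21/100 - e / c" unfolding sum(1,3) d(2) by (simp add: power2_eq_square)
  then have "0 \<le> w * x" using ec by linarith
  moreover have "0 < x" using d(1) by (simp add: wx)
  ultimately have "0 \<le> w" by (simp add: zero_le_mult_iff)
  have "c * (w * x) = c * (21/100) - e" unfolding prod using c by (simp add: field_simps)
  then have eq: "x = 1 - (e + (1 - e - c) * w + c * w^3)" "w = 1 - (e + (1 - e - c) * x + c * x^3)"
    using sum(1) cubic_weight_root[of e] unfolding c_def[symmetric] by algebra+
  have "0 \<le> e + (1 - e - c) * w + c * w^3"
    using \<open>0 \<le> w\<close> e c subprob_cubic[of e] by (simp add: subprob_def c_def)
  then have "x \<le> 1" using eq(1) by linarith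
  have "two_cycle (cubic_pmf e) w x"
    unfolding two_cycle_def pgf_cubic[OF less_imp_le[OF e(1)] e(2)]
    using \<open>0 \<le> w\<close> \<open>w < x\<close> \<open>x \<le> 1\<close> eq unfolding c_def by (intro conjI) linarith+
  then have "draw_prob (cubic_pmf e) = d"
  proof (rule draw_prob_eq_gap)
    show "w < x" "x - w = d" by fact+
    show "x' - w' = d" if "two_cycle (cubic_pmf e) w' x'" "w' < x'" for w' x'
      using two_cycle_cubic[OF e that] that(2) unfolding d_def c_def
      by (intro real_sqrt_unique[symmetric]) auto
  qed
  then show ?thesis by (simp add: d_def c_def)
qed

lemma draw_prob_cubic_0: "draw_prob (cubic_pmf 0) = 1"
proof (rule draw_prob_eq_1)
  have "subprob (1 - 0 - cubic_weight 0) 0 (cubic_weight 0) 0" by (rule subprob_cubic) simp_all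
  then show "pmf (cubic_pmf 0) 0 = 0" by (simp only: pmf_offspring_pmf) simp
qed

lemma two_transitions:
  "\<exists>p :: real \<Rightarrow> nat pmf. bounded_support_family p \<and> continuous_family p \<and>
      (\<exists>t\<^sub>1 t\<^sub>2. 0 < t\<^sub>1 \<and> t\<^sub>1 < t\<^sub>2 \<and> t\<^sub>2 < 1 \<and>
         increases_continuously_from_0_at (\<lambda>t. draw_prob (p t)) t\<^sub>1 \<and>
         jumps_between_positive_values_at (\<lambda>t. draw_prob (p t)) t\<^sub>2)"
proof -
  \<comment> \<open>The law is binary up to \<open>t = 3/8\<close> and cubic from
    \<open>t = 1/2\<close> on, with a mixture joining them continuously. The binary weight
    \<open>s\<close> passes its critical value \<open>sqrt 3 / 2\<close> at \<open>1/4\<close>;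
    \<open>e\<close> reaches \<open>0\<close> at \<open>3/4\<close>, and the divisor
    \<open>75\<close> keeps it at most \<open>1/100\<close>.\<close>
  define r :: "real \<Rightarrow> real" where "r t = max 0 (min 1 (8 * t - 3))" for t
  define s :: "real \<Rightarrow> real" where "s t = sqrt 3 / 2 + (t - 1/4) / 8" for t
  define e :: "real \<Rightarrow> real" where "e t = max 0 (3/4 - t) / 75" for t
  define a b c where "a t = r t * (1 - e t - cubic_weight (e t))" and "b t = (1 - r t) * s t"
    and "c t = r t * cubic_weight (e t)" for t
  define p where "p t = offspring_pmf (a t) (b t) (c t) 0" for t
  have r: "0 \<le> r t" "r t \<le> 1" for t by (simp_all add: r_def)
  have "17/10 \<le> sqrt 3" "sqrt 3 \<le> 9/5"
    by (rule real_le_rsqrt, simp add: power2_eq_square) (rule real_le_lsqrt, simp_all add: power2_eq_square)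
  then have s: "4/5 \<le> s t" "s t \<le> 1" if "t \<in> {0<..<1}" for t
    using that by (simp_all add: s_def field_simps)
  have e: "0 \<le> e t" "e t \<le> 1/100" if "t \<in> {0<..<1}" for t
    using that by (auto simp: e_def max_def)
  have sub: "subprob (a t) (b t) (c t) 0" if "t \<in> {0<..<1}" for t
  proof -
    have 1: "0 \<le> 1 - e t - cubic_weight (e t)" "0 \<le> cubic_weight (e t)"
      using subprob_cubic[OF e[OF that]] by (simp_all add: subprob_def)
    have "a t + b t + c t = r t * (1 - e t) + (1 - r t) * s t"
      by (simp add: a_def b_def c_def algebra_simps)
    also have "\<dots> \<le> r t * 1 + (1 - r t) * 1"
      using r[of t] e[OF that] s[OF that] by (intro add_mono mult_left_mono) auto
    finally have "a t + b t + c t \<le> 1" by simp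
    moreover have "0 \<le> a t" "0 \<le> b t" "0 \<le> c t"
      using 1 r[of t] s[OF that] by (simp_all add: a_def b_def c_def)
    ultimately show ?thesis by (simp add: subprob_def)
  qed
  have "continuous_on {0<..<1} a" "continuous_on {0<..<1} b" "continuous_on {0<..<1} c"
    unfolding a_def b_def c_def r_def s_def e_def cubic_weight_def
    by (intro continuous_intros; simp)+
  then have family: "bounded_support_family p" "continuous_family p"
    unfolding p_def using offspring_family[of a b c "\<lambda>_. 0"] sub by simp_all
  have D1: "draw_prob (p t) = sqrt (max 0 (4 - 3 / (s t)\<^sup>2))" if "t \<in> {1/8<..<3/8}" for t
  proof -
    have "r t = 0" using that by (simp add: r_def)
    then show ?thesis using draw_prob_binary[of "s t"] s[of t] that
      by (simp add: p_def a_def b_def c_def)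
  qed
  have D2: "draw_prob (p t) = draw_prob (cubic_pmf (e t))" if "1/2 < t" for t
  proof -
    have "r t = 1" using that by (simp add: r_def)
    then show ?thesis by (simp add: p_def a_def b_def c_def)
  qed
  have "increases_continuously_from_0_at (\<lambda>t. draw_prob (p t)) (1/4)"
    unfolding increases_continuously_from_0_at_def
  proof (intro exI[of _ "1/8"] conjI)
    have interval: "{1/4 - 1/8<..<1/4 + 1/8} = {1/8<..<3/8 :: real}" by simp
    have s_mono: "s t \<le> s u" if "t \<le> u" for t u using that by (simp add: s_def)
    have s_crit: "3 / (s (1/4))\<^sup>2 = 4" by (simp add: s_def power_divide)
    have rad_mono: "4 - 3 / (s t)\<^sup>2 \<le> 4 - 3 / (s u)\<^sup>2" if "t \<le> u" "t \<in> {1/8<..<3/8}" for t u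
    proof -
      have "0 < s t" using s[of t] that(2) by simp
      then have "(s t)\<^sup>2 \<le> (s u)\<^sup>2" "0 < (s t)\<^sup>2" using s_mono[OF that(1)] by (simp_all add: power_mono)
      then show ?thesis by (simp add: frac_le)
    qed
    show "\<forall>t\<in>{1/4 - 1/8<..1/4}. draw_prob (p t) = 0"
    proof
      fix t :: real assume t: "t \<in> {1/4 - 1/8<..1/4}"
      then have "4 - 3 / (s t)\<^sup>2 \<le> 0" using rad_mono[of t "1/4"] s_crit by simp
      then show "draw_prob (p t) = 0" using D1[of t] t by simp
    qed
    show "\<forall>t\<in>{1/4<..<1/4 + 1/8}. draw_prob (p t) > 0"
    proof
      fix t :: real assume t: "t \<in> {1/4<..<1/4 + 1/8}"
      have "0 < s (1/4)" "s (1/4) < s t" using t by (simp_all add: s_def)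
      then have "(s (1/4))\<^sup>2 < (s t)\<^sup>2" "0 < (s (1/4))\<^sup>2" by (simp_all add: power_strict_mono)
      then have "3 / (s t)\<^sup>2 < 3 / (s (1/4))\<^sup>2" by (simp add: frac_less2)
      then show "draw_prob (p t) > 0" using D1[of t] t s_crit by simp
    qed
    have "continuous_on {1/8<..<3/8} (\<lambda>t. sqrt (max 0 (4 - 3 / (s t)\<^sup>2)))"
    proof -
      have "s t \<noteq> 0" if "t \<in> {1/8<..<3/8}" for t using s[of t] that by fastforce
      moreover have "continuous_on {1/8<..<3/8} s" unfolding s_def by (intro continuous_intros) simp
      ultimately show ?thesis by (intro continuous_intros) auto
    qed
    then show "continuous_on {1/4 - 1/8<..<1/4 + 1/8} (\<lambda>t. draw_prob (p t))"
      unfolding interval by (rule continuous_on_eq) (rule D1[symmetric])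
    show "mono_on {1/4 - 1/8<..<1/4 + 1/8} (\<lambda>t. draw_prob (p t))"
      unfolding interval
    proof (rule mono_onI)
      fix t u :: real assume "t \<in> {1/8<..<3/8}" "u \<in> {1/8<..<3/8}" "t \<le> u"
      then show "draw_prob (p t) \<le> draw_prob (p u)"
        using D1[of t] D1[of u] rad_mono[of t u] by auto
    qed
  qed auto
  moreover have "jumps_between_positive_values_at (\<lambda>t. draw_prob (p t)) (3/4)"
    unfolding jumps_between_positive_values_at_def
  proof (intro exI conjI)
    have "((\<lambda>t. sqrt (4 * (1 + e t / cubic_weight (e t)) - 363/100)) \<longlongrightarrow>
        sqrt (4 * (1 + e (3/4) / cubic_weight (e (3/4))) - 363/100)) (at_left (3/4))"
      unfolding e_def cubic_weight_def by (intro tendsto_intros) simp_all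
    moreover have "\<forall>\<^sub>F t in at_left (3/4). draw_prob (p t) =
        sqrt (4 * (1 + e t / cubic_weight (e t)) - 363/100)"
    proof (rule eventually_at_leftI[of "1/2"])
      fix t :: real assume t: "t \<in> {1/2<..<3/4}"
      then have "0 < e t" "e t \<le> 1/100" by (simp_all add: e_def)
      then show "draw_prob (p t) = sqrt (4 * (1 + e t / cubic_weight (e t)) - 363/100)"
        using D2[of t] t draw_prob_cubic[of "e t"] by simp
    qed simp
    \<comment> \<open>At \<open>e = 0\<close> the radicand is \<open>4 - 363/100\<close>.\<close>
    ultimately show "((\<lambda>t. draw_prob (p t)) \<longlongrightarrow> sqrt (37/100)) (at_left (3/4))"
      using tendsto_cong by (force simp: e_def)
    have "\<forall>\<^sub>F t in at_right (3/4). draw_prob (p t) = 1"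
    proof (rule eventually_at_rightI[of _ 1])
      fix t :: real assume t: "t \<in> {3/4<..<1}"
      then have "e t = 0" by (simp add: e_def)
      then show "draw_prob (p t) = 1" using D2[of t] t draw_prob_cubic_0 by simp
    qed simp
    then show "((\<lambda>t. draw_prob (p t)) \<longlongrightarrow> 1) (at_right (3/4))"
      by (rule tendsto_eventually)
    show "sqrt (37/100) > 0" "(1 :: real) > 0" "sqrt (37/100) \<noteq> 1" by simp_all
  qed
  ultimately have "\<exists>t\<^sub>1 t\<^sub>2. 0 < t\<^sub>1 \<and> t\<^sub>1 < t\<^sub>2 \<and> t\<^sub>2 < 1 \<and>
      increases_continuously_from_0_at (\<lambda>t. draw_prob (p t)) t\<^sub>1 \<and>
      jumps_between_positive_values_at (\<lambda>t. draw_prob (p t)) t\<^sub>2"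
    by (intro exI[of _ "1/4"] exI[of _ "3/4"]) simp
  then show ?thesis using family by blast
qed

subsection \<open>A continuous transition of the escape game\<close>

text \<open>
  The weights make \<open>x\<close> and \<open>y = 4/5 * x\<close> solve \<open>y = a * x + c * x^3\<close>,
  \<open>x = a * y + c * (3 * y - 3 * y^2 + y^3)\<close>, the equations for the probabilities that the escaper
  wins when moving first and when moving second.
\<close>

definition escape_weight :: "real \<Rightarrow> real" where
  "escape_weight x = 45/100 / (3 - 12/5 * x - 9/25 * x\<^sup>2)"

abbreviation escape_pmf :: "real \<Rightarrow> nat pmf" where
  "escape_pmf x \<equiv> offspring_pmf (4/5 - escape_weight x * x\<^sup>2) 0 (escape_weight x) 0"

lemma escape_weight_denominator:
  fixes x :: real
  assumes "0 \<le> x" "x \<le> 1/100"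
  shows "297/100 \<le> 3 - 12/5 * x - 9/25 * x\<^sup>2" "3 - 12/5 * x - 9/25 * x\<^sup>2 \<le> 3"
    and "x\<^sup>2 \<le> 1/10000"
proof -
  have "x\<^sup>2 \<le> (1/100)\<^sup>2" using assms by (intro power_mono)
  then show "x\<^sup>2 \<le> 1/10000" by (simp add: power2_eq_square)
  then show "297/100 \<le> 3 - 12/5 * x - 9/25 * x\<^sup>2" "3 - 12/5 * x - 9/25 * x\<^sup>2 \<le> 3"
    using assms zero_le_power2[of x] by linarith+
qed

lemma escape_weight_bounds:
  assumes "0 \<le> x" "x \<le> 1/100"
  shows "0 < escape_weight x" "escape_weight x \<le> 5/33"
proof -
  note D = escape_weight_denominator[OF assms]
  show "0 < escape_weight x" unfolding escape_weight_def using D(1) by (intro divide_pos_pos) simp_all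
  have "45/100 / (3 - 12/5 * x - 9/25 * x\<^sup>2) \<le> 45/100 / (297/100)"
    using D(1) by (intro frac_le) simp_all
  then show "escape_weight x \<le> 5/33" unfolding escape_weight_def by simp
qed

lemma subprob_escape:
  assumes "0 \<le> x" "x \<le> 1/100"
  shows "subprob (4/5 - escape_weight x * x\<^sup>2) 0 (escape_weight x) 0"
proof -
  have "escape_weight x * x\<^sup>2 \<le> (5/33) * (1/10000)" "0 \<le> escape_weight x * x\<^sup>2"
    using escape_weight_bounds[OF assms] escape_weight_denominator(3)[OF assms]
      mult_mono[of "escape_weight x" "5/33" "x\<^sup>2" "1/10000"] by simp_all
  then show ?thesis using escape_weight_bounds[OF assms] unfolding subprob_def by linarith
qed

text \<open>The weights make \<open>x\<close> a solution, so it is at most the largest one. For a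
  larger solution \<open>X\<close> the factor \<open>q\<close> of the first step would have to grow
  enough to offset the decrease of the factor \<open>K\<close> of the second, and it grows too
  slowly.\<close>

lemma escape_prob1_escape_pmf:
  assumes x: "0 \<le> x" "x \<le> 1/100"
  shows "escape_prob1 (escape_pmf x) = x"
proof -
  define c where "c = escape_weight x"
  define a where "a = 4/5 - c * x\<^sup>2"
  define y where "y = 4/5 * x"
  let ?p = "offspring_pmf a 0 c 0"
  have sub: "subprob a 0 c 0" unfolding a_def c_def by (rule subprob_escape[OF x])
  have c: "0 < c" "c \<le> 5/33" unfolding c_def by (rule escape_weight_bounds[OF x])+
  have a: "0 \<le> a" "a \<le> 4/5" using sub c by (simp_all add: subprob_def a_def)
  define K where "K z = a + 3 * c - 3 * c * z + c * z\<^sup>2" for z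
  have step1: "pgf ?p z - pmf ?p 0 = z * (a + c * z\<^sup>2)" for z
    unfolding pgf_offspring_pmf[OF sub] pmf_offspring_pmf[OF sub]
    by (simp add: algebra_simps power2_eq_square power3_eq_cube)
  have step2: "1 - pgf ?p (1 - z) = z * K z" for z
    unfolding pgf_offspring_pmf[OF sub] K_def
    by (simp add: algebra_simps power2_eq_square power3_eq_cube)
  have "3 - 12/5 * x - 9/25 * x\<^sup>2 \<noteq> 0" using escape_weight_denominator(1)[OF x] by linarith
  from iffD1[OF nonzero_eq_divide_eq[OF this] c_def[unfolded escape_weight_def]]
  \<comment> \<open>Here \<open>45/100\<close> is \<open>5/4 - 4/5\<close>: the second step must
    multiply \<open>y = 4/5 * x\<close> by \<open>5/4\<close>.\<close>
  have "c * (3 - 12/5 * x - 9/25 * x\<^sup>2) = 45/100" .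
  then have Ky: "4/5 * K y = 1" unfolding K_def a_def y_def by (simp add: power2_eq_square algebra_simps)
  obtain Y where E: "escape_prob1 ?p \<in> {0..1}" "Y = pgf ?p (escape_prob1 ?p) - pmf ?p 0"
      "escape_prob1 ?p = 1 - pgf ?p (1 - Y)"
    and ext: "\<And>x' y'. \<lbrakk>0 \<le> x'; x' \<le> 1; y' = pgf ?p x' - pmf ?p 0; x' = 1 - pgf ?p (1 - y')\<rbrakk>
       \<Longrightarrow> x' \<le> escape_prob1 ?p"
    by (rule escape_prob1_fixed_point[of ?p]) blast
  define X where "X = escape_prob1 ?p"
  have "x \<le> X" unfolding X_def
  proof (rule ext)
    show "y = pgf ?p x - pmf ?p 0" unfolding step1 by (simp add: a_def y_def)
    show "x = 1 - pgf ?p (1 - y)" unfolding step2 using Ky by (simp add: y_def)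
  qed (use x in auto)
  moreover have "\<not> x < X"
  proof
    assume less: "x < X"
    have X: "0 < X" "X \<le> 1" using E(1) less x unfolding X_def by auto
    define q where "q = a + c * X\<^sup>2"
    have "X\<^sup>2 \<le> 1" using X by (simp add: power_le_one)
    then have "c * X\<^sup>2 \<le> c" using c(1) by simp
    have "c * x\<^sup>2 \<le> c * X\<^sup>2" using less x(1) c(1) by (simp add: power_mono)
    then have q: "4/5 \<le> q" "q \<le> 24/25"
      using \<open>c * X\<^sup>2 \<le> c\<close> a c(2) unfolding q_def a_def by linarith+
    have Y: "Y = q * X" using E(2) unfolding step1 q_def X_def by simp
    have "X = Y * K Y" using E(3) unfolding step2 X_def .
    then have "X * (q * K Y - 1) = 0" using Y by algebra
    then have qK: "q * K Y = 1" using X(1) by simp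
    have Y_bounds: "0 \<le> Y" "Y \<le> 24/25" "4/5 * X \<le> Y"
      using X q mult_mono[of q "24/25" X 1] unfolding Y by auto
    \<comment> \<open>Both products of factors, \<open>q * K Y\<close> and \<open>4/5 * K y\<close>,
      equal \<open>1\<close>. The two differences each carry a factor \<open>c\<close>, which
      cancels.\<close>
    have "(q - 4/5) * K Y = 4/5 * (K y - K Y)" using qK Ky by algebra
    moreover have "q - 4/5 = c * ((X - x) * (X + x))" unfolding q_def a_def by algebra
    moreover have "K y - K Y = c * ((Y - y) * (3 - Y - y))" unfolding K_def by algebra
    ultimately have "c * ((X - x) * (X + x) * K Y) = c * (4/5 * ((Y - y) * (3 - Y - y)))" by algebra
    then have eq: "(X - x) * ((X + x) * K Y) = 4/5 * ((Y - y) * (3 - Y - y))" using c(1) by simp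
    have "K Y \<le> 63/50"
    proof -
      have "Y\<^sup>2 \<le> 3 * Y" using Y_bounds by (simp add: power2_eq_square mult_right_mono)
      then have "c * Y\<^sup>2 \<le> c * (3 * Y)" using c(1) by (intro mult_left_mono) auto
      then show ?thesis using a(2) c(2) unfolding K_def by linarith
    qed
    moreover have "0 \<le> K Y" using qK q(1) zero_less_mult_iff[of q "K Y"] by simp
    ultimately have "(X + x) * K Y \<le> 101/100 * (63/50)" using X x by (intro mult_mono) auto
    then have "(X - x) * ((X + x) * K Y) \<le> (X - x) * (101/100 * (63/50))"
      using less by (intro mult_left_mono) auto
    moreover have "4/5 * (X - x) * 2 \<le> (Y - y) * (3 - Y - y)"
      using less Y_bounds x unfolding y_def by (intro mult_mono) auto
    \<comment> \<open>The contradiction is \<open>1.28\<close> against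
      \<open>1.2726\<close>.\<close>
    ultimately have "(X - x) * (4/5 * (4/5 * 2)) \<le> (X - x) * (101/100 * (63/50))"
      using eq by argo
    then show False using less by simp
  qed
  ultimately show ?thesis by (simp add: X_def a_def c_def)
qed

lemma escape_transition:
  "\<exists>p :: real \<Rightarrow> nat pmf. bounded_support_family p \<and> continuous_family p \<and>
      (\<exists>t\<^sub>e\<in>{0<..<1}.
         (\<forall>t\<in>{0<..<1}. t \<le> t\<^sub>e \<longrightarrow> escape_prob1 (p t) = 0) \<and>
         (\<forall>t\<in>{0<..<1}. t > t\<^sub>e \<longrightarrow> escape_prob1 (p t) \<in> {0<..<1}) \<and>
         continuous_on {0<..<1} (\<lambda>t. escape_prob1 (p t)))"
proof -
  \<comment> \<open>The escape probability is prescribed: zero up to \<open>t = 1/2\<close>, then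
    linear and small enough for the weights to be admissible.\<close>
  define x :: "real \<Rightarrow> real" where "x t = max 0 (t - 1/2) / 100" for t
  have x: "0 \<le> x t" "x t \<le> 1/100" if "t \<in> {0<..<1}" for t
    using that by (auto simp: x_def max_def)
  have E: "escape_prob1 (escape_pmf (x t)) = x t" if "t \<in> {0<..<1}" for t
    by (rule escape_prob1_escape_pmf[OF x[OF that]])
  have cont: "continuous_on {0<..<1} x" unfolding x_def by (intro continuous_intros) simp
  have "3 - 12/5 * x t - 9/25 * (x t)\<^sup>2 \<noteq> 0" if "t \<in> {0<..<1}" for t
    using escape_weight_denominator(1)[OF x[OF that]] by linarith
  then have "continuous_on {0<..<1} (\<lambda>t. escape_weight (x t))"
    unfolding escape_weight_def by (intro continuous_intros cont) auto
  then have "bounded_support_family (\<lambda>t. escape_pmf (x t))"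
    "continuous_family (\<lambda>t. escape_pmf (x t))"
    using subprob_escape[OF x] cont
    by (intro offspring_family continuous_intros; blast)+
  moreover have "continuous_on {0<..<1} (\<lambda>t. escape_prob1 (escape_pmf (x t)))"
    using cont by (rule continuous_on_eq) (rule E[symmetric])
  moreover have "\<forall>t\<in>{0<..<1}. t \<le> 1/2 \<longrightarrow> escape_prob1 (escape_pmf (x t)) = 0"
    "\<forall>t\<in>{0<..<1}. t > 1/2 \<longrightarrow> escape_prob1 (escape_pmf (x t)) \<in> {0<..<1}"
    by (auto simp: E) (auto simp: x_def)
  moreover have "1/2 \<in> {0<..<1 :: real}" by simp
  ultimately show ?thesis by blast
qed

theorem proposition4:
  shows "(\<exists>p :: real \<Rightarrow> nat pmf. bounded_support_family p \<and> continuous_family p \<and>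
      (\<exists>t\<^sub>c\<in>{0<..<1}.
         (\<forall>t\<in>{0<..<1}. t < t\<^sub>c \<longrightarrow> draw_prob (p t) = 0) \<and>
         (\<forall>t\<in>{0<..<1}. t \<ge> t\<^sub>c \<longrightarrow> draw_prob (p t) \<in> {0<..<1}) \<and>
         pmf (p t\<^sub>c) 1 < 1))
    \<and> (\<exists>p :: real \<Rightarrow> nat pmf. bounded_support_family p \<and> continuous_family p \<and>
      (\<exists>t\<^sub>1 t\<^sub>2. 0 < t\<^sub>1 \<and> t\<^sub>1 < t\<^sub>2 \<and> t\<^sub>2 < 1 \<and>
         increases_continuously_from_0_at (\<lambda>t. draw_prob (p t)) t\<^sub>1 \<and>
         jumps_between_positive_values_at (\<lambda>t. draw_prob (p t)) t\<^sub>2))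
    \<and> (\<exists>p :: real \<Rightarrow> nat pmf. bounded_support_family p \<and> continuous_family p \<and>
      (\<exists>t\<^sub>e\<in>{0<..<1}.
         (\<forall>t\<in>{0<..<1}. t \<le> t\<^sub>e \<longrightarrow> escape_prob1 (p t) = 0) \<and>
         (\<forall>t\<in>{0<..<1}. t > t\<^sub>e \<longrightarrow> escape_prob1 (p t) \<in> {0<..<1}) \<and>
         continuous_on {0<..<1} (\<lambda>t. escape_prob1 (p t))))"
  using discontinuous_transition two_transitions escape_transition by blast

end
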